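(* Let $n>0$ and $r\ge 2$ be integers. Let $Y=\mathbb{P}^{n_1}\times\cdots\times\mathbb{P}^{n_k}$ (all $n_i>0$) be a multiprojective space with $\dim Y=n_1+\cdots+n_k=n$, and let $S\subset Y$ be a set of $r$ distinct points. Then $$h^1\left(\mathcal{I}_{(2S,Y)}(1,\dots,1)\right)\le (r-1)(n+1),$$ and equality holds if and only if $Y=\mathbb{P}^n$ (i.e. $k=1$).
   Context: We work over an algebraically closed field of characteristic $0$. For $p\in Y$, $(2p,Y)$ denotes the closed subscheme of $Y$ with ideal sheaf $(\mathcal{I}_{p,Y})^2$, and for a finite set $S\subset Y$, $(2S,Y)=\bigcup_{p\in S}(2p,Y)$. *)

theory Defs
  imports
    "HOL-Computational_Algebra.Polynomial"
    "HOL-Library.Poly_Mapping"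
    "HOL-Library.Function_Algebras"
    "HOL-Library.Extended_Nat"
    "HOL-Library.FuncSet"
begin

section \<open>Projective and multiprojective space\<close>

text \<open>
  The vector space \<open>k^(m+1)\<close> is modelled by functions \<open>nat \<Rightarrow> k\<close> that vanish beyond index \<open>m\<close>.
  A point of \<open>P^m\<close> is the set of all its homogeneous coordinate vectors.
\<close>

definition nonzero_vectors :: "nat \<Rightarrow> (nat \<Rightarrow> 'k::field) set" where
  "nonzero_vectors m = {v. (\<exists>j. v j \<noteq> 0) \<and> (\<forall>j>m. v j = 0)}"

definition proportional :: "nat \<Rightarrow> ((nat \<Rightarrow> 'k::field) \<times> (nat \<Rightarrow> 'k)) set" where
  "proportional m = {(v, w). v \<in> nonzero_vectors m \<and> w \<in> nonzero_vectors m \<and>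
     (\<exists>c. c \<noteq> 0 \<and> w = (\<lambda>j. c * v j))}"

definition proj_space :: "nat \<Rightarrow> (nat \<Rightarrow> 'k::field) set set" where
  "proj_space m = nonzero_vectors m // proportional m"

text \<open>The list \<open>ns = [n\<^sub>1, \<dots>, n\<^sub>k]\<close> stands for \<open>Y = P^(n\<^sub>1) \<times> \<dots> \<times> P^(n\<^sub>k)\<close>; factors are numbered from 0.\<close>

definition multiproj_space :: "nat list \<Rightarrow> (nat \<Rightarrow> (nat \<Rightarrow> 'k::field) set) set" where
  "multiproj_space ns = (\<Pi>\<^sub>E i\<in>{..<length ns}. proj_space (ns ! i))"

section \<open>Standard affine charts and Laurent polynomials\<close>

text \<open>
  The chart \<open>a\<close> selects one coordinate \<open>x (i, a i)\<close> in each factor and is the affine open set where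
  all the selected coordinates are nonzero. For a nonempty set \<open>A\<close> of charts, \<open>chart_points ns A\<close> is
  the (again affine) intersection \<open>U\<^sub>A\<close> of the charts in \<open>A\<close>.
\<close>

definition charts :: "nat list \<Rightarrow> (nat \<Rightarrow> nat) set" where
  "charts ns = (\<Pi>\<^sub>E i\<in>{..<length ns}. {..ns ! i})"

definition chart_points :: "nat list \<Rightarrow> (nat \<Rightarrow> nat) set \<Rightarrow> (nat \<Rightarrow> (nat \<Rightarrow> 'k::field) set) set" where
  "chart_points ns A = {p \<in> multiproj_space ns. \<forall>a\<in>A. \<forall>i<length ns. \<forall>v\<in>p i. v (a i) \<noteq> 0}"

text \<open>
  Laurent polynomials in variables \<open>x (i, j)\<close> (\<open>i\<close> the factor, \<open>j\<close> the homogeneous coordinate).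
  Every localisation of the multihomogeneous coordinate ring of \<open>Y\<close> at a product of variables is a
  subring of the Laurent polynomial ring, so restriction maps between the \<open>U\<^sub>A\<close> become inclusions.
\<close>

type_synonym 'k laurent = "((nat \<times> nat) \<Rightarrow>\<^sub>0 int) \<Rightarrow>\<^sub>0 'k"

definition const_laurent :: "'k::zero \<Rightarrow> 'k laurent" where
  "const_laurent c = Poly_Mapping.single 0 c"

definition eval_laurent :: "(nat \<Rightarrow> nat \<Rightarrow> 'k::field) \<Rightarrow> 'k laurent \<Rightarrow> 'k" where
  "eval_laurent v f = (\<Sum>m\<in>Poly_Mapping.keys f. Poly_Mapping.lookup f m *
     (\<Prod>(i, j)\<in>Poly_Mapping.keys m. v i j powi Poly_Mapping.lookup m (i, j)))"

section \<open>Sheaves on multiprojective space\<close>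

text \<open>
  All sheaves below are quasi-coherent subsheaves of a line bundle and are given by their modules
  of sections over the affine open sets \<open>U\<^sub>A\<close>.

  \<open>line_bundle ns d A\<close> is \<open>\<Gamma>(U\<^sub>A, \<O>(d\<^sub>1, \<dots>, d\<^sub>k))\<close>: the part of multidegree \<open>d\<close> of the multihomogeneous
  coordinate ring with the variables selected by the charts in \<open>A\<close> inverted.
\<close>

definition line_bundle :: "nat list \<Rightarrow> (nat \<Rightarrow> int) \<Rightarrow> (nat \<Rightarrow> nat) set \<Rightarrow> 'k::field laurent set" where
  "line_bundle ns d A = {f. \<forall>m\<in>Poly_Mapping.keys f.
     (\<forall>(i, j)\<in>Poly_Mapping.keys m. i < length ns \<and> j \<le> ns ! i) \<and>
     (\<forall>i j. Poly_Mapping.lookup m (i, j) < 0 \<longrightarrow> (\<exists>a\<in>A. j = a i)) \<and>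
     (\<forall>i<length ns. (\<Sum>j\<le>ns ! i. Poly_Mapping.lookup m (i, j)) = d i)}"

definition structure_sheaf :: "nat list \<Rightarrow> (nat \<Rightarrow> nat) set \<Rightarrow> 'k::field laurent set" where
  "structure_sheaf ns = line_bundle ns (\<lambda>_. 0)"

definition point_ideal_sheaf ::
    "nat list \<Rightarrow> (nat \<Rightarrow> (nat \<Rightarrow> 'k::field) set) \<Rightarrow> (nat \<Rightarrow> nat) set \<Rightarrow> 'k laurent set" where
  "point_ideal_sheaf ns p A = {f \<in> structure_sheaf ns A. p \<in> chart_points ns A \<longrightarrow>
     (\<forall>v. (\<forall>i<length ns. v i \<in> p i) \<longrightarrow> eval_laurent v f = 0)}"

definition module_product :: "'a::comm_ring_1 set \<Rightarrow> 'a set \<Rightarrow> 'a set" where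
  "module_product I M = {\<Sum>t<(N::nat). f t * g t | N f g. \<forall>t<N. f t \<in> I \<and> g t \<in> M}"

definition double_point_ideal_sheaf ::
    "nat list \<Rightarrow> (nat \<Rightarrow> (nat \<Rightarrow> 'k::field) set) \<Rightarrow> (nat \<Rightarrow> nat) set \<Rightarrow> 'k laurent set" where
  "double_point_ideal_sheaf ns p A = module_product (point_ideal_sheaf ns p A) (point_ideal_sheaf ns p A)"

text \<open>The ideal sheaf of a union of closed subschemes is the intersection of their ideal sheaves.\<close>

definition double_points_ideal_sheaf ::
    "nat list \<Rightarrow> (nat \<Rightarrow> (nat \<Rightarrow> 'k::field) set) set \<Rightarrow> (nat \<Rightarrow> nat) set \<Rightarrow> 'k laurent set" where
  "double_points_ideal_sheaf ns S A =
     structure_sheaf ns A \<inter> (\<Inter>p\<in>S. double_point_ideal_sheaf ns p A)"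

text \<open>
  The twist \<open>\<I>(d) = \<I> \<otimes> \<O>(d)\<close> of an ideal sheaf. Since \<open>\<O>(d)\<close> is locally free, the multiplication map
  \<open>\<Gamma>(U\<^sub>A, \<I>) \<otimes> \<Gamma>(U\<^sub>A, \<O>(d)) \<rightarrow> \<Gamma>(U\<^sub>A, \<O>(d))\<close> is injective, so the tensor product is its image.
\<close>

definition twist ::
    "nat list \<Rightarrow> (nat \<Rightarrow> int) \<Rightarrow> ((nat \<Rightarrow> nat) set \<Rightarrow> 'k::field laurent set) \<Rightarrow> (nat \<Rightarrow> nat) set \<Rightarrow> 'k laurent set" where
  "twist ns d I A = module_product (I A) (line_bundle ns d A)"

section \<open>First cohomology\<close>

text \<open>
  Dimension of \<open>V / W\<close> for subspaces \<open>W \<subseteq> V\<close>, with value \<open>\<infinity>\<close> if it is not finite: the supremum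
  of the sizes of finite subsets of \<open>V\<close> that are linearly independent modulo \<open>W\<close>.
\<close>

definition quotient_dim ::
    "('k::zero \<Rightarrow> 'v \<Rightarrow> 'v::comm_monoid_add) \<Rightarrow> 'v set \<Rightarrow> 'v set \<Rightarrow> enat" where
  "quotient_dim scale V W = Sup {enat (card B) | B. finite B \<and> B \<subseteq> V \<and>
     (\<forall>c. (\<Sum>b\<in>B. scale (c b) b) \<in> W \<longrightarrow> (\<forall>b\<in>B. c b = 0))}"

text \<open>
  Cech 1-cocycles and 1-coboundaries of a cover indexed by \<open>J\<close>, where \<open>F A\<close> is the module of sections
  over the intersection of the members of the cover indexed by \<open>A\<close> and restrictions are inclusions.
  Cochains are families over all ordered pairs, extended by 0 outside \<open>J \<times> J\<close>; the cocycle
  condition makes cocycles alternating.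
\<close>

definition cech_cocycles1 :: "'i set \<Rightarrow> ('i set \<Rightarrow> 'm::ab_group_add set) \<Rightarrow> ('i \<Rightarrow> 'i \<Rightarrow> 'm) set" where
  "cech_cocycles1 J F = {g.
     (\<forall>a\<in>J. \<forall>b\<in>J. g a b \<in> F {a, b}) \<and>
     (\<forall>a b. a \<notin> J \<or> b \<notin> J \<longrightarrow> g a b = 0) \<and>
     (\<forall>a\<in>J. \<forall>b\<in>J. \<forall>c\<in>J. g b c - g a c + g a b = 0)}"

definition cech_coboundaries1 :: "'i set \<Rightarrow> ('i set \<Rightarrow> 'm::ab_group_add set) \<Rightarrow> ('i \<Rightarrow> 'i \<Rightarrow> 'm) set" where
  "cech_coboundaries1 J F =
     {(\<lambda>a b. if a \<in> J \<and> b \<in> J then f b - f a else 0) | f. \<forall>a\<in>J. f a \<in> F {a}}"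

text \<open>
  \<open>h1 ns F = dim H^1(Y, F)\<close>, with cohomology of quasi-coherent sheaves defined by the Cech complex
  of the finite affine cover of the separated scheme \<open>Y\<close> by its standard charts.
\<close>

definition h1 :: "nat list \<Rightarrow> ((nat \<Rightarrow> nat) set \<Rightarrow> 'k::field laurent set) \<Rightarrow> enat" where
  "h1 ns F = quotient_dim (\<lambda>c g a b. const_laurent c * g a b)
     (cech_cocycles1 (charts ns) F) (cech_coboundaries1 (charts ns) F)"

end

theory Submission
  imports Defs "HOL-Computational_Algebra.Formal_Laurent_Series"
begin

text \<open>
  Since \<open>H\<^sup>1(\<O>(1, \<dots>, 1)) = 0\<close>, a cocycle of the ideal sheaf is the coboundary of a cochain of
  \<open>\<O>(1, \<dots>, 1)\<close>, whose first-order jets at the points of \<open>S\<close>, modulo the jets of global sections,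
  determine its class; so \<open>h\<^sup>1\<close> is \<open>r (n + 1)\<close> minus the rank of the jet map on global sections.
  One point already contributes rank \<open>n + 1\<close>. On \<open>P\<^sup>n\<close> this is everything, as there are only \<open>n + 1\<close>
  linear forms. On a product with at least two factors, a product of linear forms vanishing doubly at
  one point of \<open>S\<close> but not at another one raises the rank.

  The square of the ideal of a point is described without derivatives: modulo it, every function on
  a chart is a combination of \<open>1\<close> and the affine coordinates, and such a combination lies in it only
  if it is zero, because restricting to lines through the point sends the square of the ideal into
  the power series of order at least two.
\<close>

section \<open>Evaluation of Laurent polynomials\<close>

text \<open>Exact sequences are replaced by counting. If independent classes and global sections
  with independent jets on \<open>2S\<close> together outnumber the r(n+1) Taylor coefficients, a
  homogeneous linear system yields a nontrivial combination with all jets zero, contradicting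
  independence. So n+1 such sections give the bound (r-1)(n+1), and an (n+2)nd one makes it strict.
  For the reverse bound, (r-1)(n+1) explicit cocycles are exhibited. The obstacle is that the
  conditions on a cocycle live on overlaps of charts, those on a coboundary live on single charts,
  and the square of an ideal is only a set of finite sums of products. Ideal membership must
  therefore descend from an overlap containing the point to a whole chart. Taylor expansion achieves
  this: it is carried out on the large chart, and the remaining jet is recognised as zero on the
  overlap. Formal Laurent series serve as test objects because they form a field, so Laurent
  polynomials can be evaluated in them, and because a directional derivative is then just the
  coefficient of X.\<close>

definition monomial_value :: "('x \<Rightarrow> 'a::field) \<Rightarrow> ('x \<Rightarrow>\<^sub>0 int) \<Rightarrow> 'a" where
  "monomial_value x m = (\<Prod>k\<in>Poly_Mapping.keys m. x k powi Poly_Mapping.lookup m k)"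

text \<open>Coefficients and values lie in different fields so that one set of lemmas covers both
  uses: the value at a point (with the identity) and the restriction to a line (with
  \<open>fls_const\<close>).\<close>

definition laurent_value ::
    "('k::field \<Rightarrow> 'a::field) \<Rightarrow> ('x \<Rightarrow> 'a) \<Rightarrow> (('x \<Rightarrow>\<^sub>0 int) \<Rightarrow>\<^sub>0 'k) \<Rightarrow> 'a" where
  "laurent_value \<phi> x f =
     (\<Sum>m\<in>Poly_Mapping.keys f. \<phi> (Poly_Mapping.lookup f m) * monomial_value x m)"

text \<open>A negative power of 0 is 0 in HOL, so every monomial has some value, but values are
  multiplicative only away from poles. This predicate excludes the poles.\<close>

definition monomial_defined_at :: "('x \<Rightarrow> 'a::field) \<Rightarrow> ('x \<Rightarrow>\<^sub>0 int) \<Rightarrow> bool" where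
  "monomial_defined_at x m \<longleftrightarrow> (\<forall>k. Poly_Mapping.lookup m k < 0 \<longrightarrow> x k \<noteq> 0)"

definition defined_at :: "('x \<Rightarrow> 'a::field) \<Rightarrow> (('x \<Rightarrow>\<^sub>0 int) \<Rightarrow>\<^sub>0 'k::zero) \<Rightarrow> bool" where
  "defined_at x f \<longleftrightarrow> (\<forall>m\<in>Poly_Mapping.keys f. monomial_defined_at x m)"

definition field_hom :: "('k::field \<Rightarrow> 'a::field) \<Rightarrow> bool" where
  "field_hom \<phi> \<longleftrightarrow> \<phi> 0 = 0 \<and> \<phi> 1 = 1 \<and>
     (\<forall>a b. \<phi> (a + b) = \<phi> a + \<phi> b) \<and> (\<forall>a b. \<phi> (a * b) = \<phi> a * \<phi> b)"

lemma field_hom_id: "field_hom (\<lambda>c. c)"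
  by (simp add: field_hom_def)

lemma field_hom_fls_const: "field_hom (fls_const :: 'k::field \<Rightarrow> 'k fls)"
  by (simp add: field_hom_def fls_plus_const)

lemma monomial_value_superset:
  assumes "finite K" "Poly_Mapping.keys m \<subseteq> K"
  shows "monomial_value x m = (\<Prod>k\<in>K. x k powi Poly_Mapping.lookup m k)"
  unfolding monomial_value_def using assms
  by (intro prod.mono_neutral_left) (auto simp: in_keys_iff)

lemma monomial_value_zero [simp]: "monomial_value x 0 = 1"
  by (simp add: monomial_value_def)

lemma monomial_value_single: "monomial_value x (Poly_Mapping.single k e) = x k powi e"
  by (simp add: monomial_value_def)

lemma powi_add_defined:
  fixes a :: "'a::field"
  assumes "i < 0 \<Longrightarrow> a \<noteq> 0" "j < 0 \<Longrightarrow> a \<noteq> 0"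
  shows "a powi (i + j) = a powi i * a powi j"
proof (cases "a = 0")
  case True
  then have "i \<ge> 0" "j \<ge> 0" using assms by force+
  then show ?thesis
    by (simp add: power_int_nonneg_exp nat_add_distrib power_add)
qed (simp add: power_int_add)

lemma monomial_value_add:
  assumes "monomial_defined_at x m" "monomial_defined_at x m'"
  shows "monomial_value x (m + m') = monomial_value x m * monomial_value x m'"
proof -
  let ?K = "Poly_Mapping.keys m \<union> Poly_Mapping.keys m'"
  have "monomial_value x (m + m') =
      (\<Prod>k\<in>?K. x k powi Poly_Mapping.lookup m k * x k powi Poly_Mapping.lookup m' k)"
    using assms keys_add[of m m']
    by (subst monomial_value_superset[of ?K])
      (auto simp: lookup_add monomial_defined_at_def intro!: prod.cong powi_add_defined)
  also have "\<dots> = monomial_value x m * monomial_value x m'"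
    by (simp add: prod.distrib monomial_value_superset[of ?K])
  finally show ?thesis .
qed

lemma monomial_defined_at_zero [simp]: "monomial_defined_at x 0"
  by (simp add: monomial_defined_at_def)

lemma defined_at_single: "monomial_defined_at x m \<Longrightarrow> defined_at x (Poly_Mapping.single m c)"
  by (simp add: defined_at_def)

lemma laurent_value_superset:
  assumes "field_hom \<phi>" "finite K" "Poly_Mapping.keys f \<subseteq> K"
  shows "laurent_value \<phi> x f = (\<Sum>m\<in>K. \<phi> (Poly_Mapping.lookup f m) * monomial_value x m)"
  unfolding laurent_value_def using assms
  by (intro sum.mono_neutral_left) (auto simp: in_keys_iff field_hom_def)

lemma laurent_value_single:
  "field_hom \<phi> \<Longrightarrow> laurent_value \<phi> x (Poly_Mapping.single m c) = \<phi> c * monomial_value x m"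
  by (simp add: laurent_value_superset[of \<phi> "{m}"])

lemma laurent_value_zero [simp]: "laurent_value \<phi> x 0 = 0"
  by (simp add: laurent_value_def)

lemma laurent_value_add:
  assumes "field_hom \<phi>"
  shows "laurent_value \<phi> x (f + g) = laurent_value \<phi> x f + laurent_value \<phi> x g"
proof -
  let ?K = "Poly_Mapping.keys f \<union> Poly_Mapping.keys g"
  have "laurent_value \<phi> x (f + g) = (\<Sum>m\<in>?K. \<phi> (Poly_Mapping.lookup f m) * monomial_value x m
      + \<phi> (Poly_Mapping.lookup g m) * monomial_value x m)"
    using assms keys_add[of f g]
    by (subst laurent_value_superset[of \<phi> ?K]) (auto simp: lookup_add field_hom_def algebra_simps)
  also have "\<dots> = laurent_value \<phi> x f + laurent_value \<phi> x g"
    using assms by (simp add: sum.distrib laurent_value_superset[of \<phi> ?K])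
  finally show ?thesis .
qed

lemma laurent_value_sum:
  "field_hom \<phi> \<Longrightarrow> laurent_value \<phi> x (\<Sum>t\<in>T. f t) = (\<Sum>t\<in>T. laurent_value \<phi> x (f t))"
  by (induction T rule: infinite_finite_induct) (simp_all add: laurent_value_add)

lemma laurent_expansion:
  "f = (\<Sum>m\<in>Poly_Mapping.keys f. Poly_Mapping.single m (Poly_Mapping.lookup f m))"
proof (rule poly_mapping_eqI)
  fix m
  show "Poly_Mapping.lookup f m = Poly_Mapping.lookup
      (\<Sum>m\<in>Poly_Mapping.keys f. Poly_Mapping.single m (Poly_Mapping.lookup f m)) m"
    by (simp add: lookup_sum lookup_single when_def in_keys_iff)
qed

lemma laurent_value_mult:
  assumes \<phi>: "field_hom \<phi>" and f: "defined_at x f" and g: "defined_at x g"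
  shows "laurent_value \<phi> x (f * g) = laurent_value \<phi> x f * laurent_value \<phi> x g"
proof -
  have "f * g = (\<Sum>m\<in>Poly_Mapping.keys f. \<Sum>m'\<in>Poly_Mapping.keys g.
      Poly_Mapping.single (m + m') (Poly_Mapping.lookup f m * Poly_Mapping.lookup g m'))"
    by (subst laurent_expansion[of f], subst laurent_expansion[of g])
      (simp add: sum_product mult_single)
  then have "laurent_value \<phi> x (f * g) = (\<Sum>m\<in>Poly_Mapping.keys f. \<Sum>m'\<in>Poly_Mapping.keys g.
      (\<phi> (Poly_Mapping.lookup f m) * \<phi> (Poly_Mapping.lookup g m')) * monomial_value x (m + m'))"
    using \<phi> by (simp add: laurent_value_sum laurent_value_single) (simp add: field_hom_def)
  also have "\<dots> = (\<Sum>m\<in>Poly_Mapping.keys f. \<Sum>m'\<in>Poly_Mapping.keys g.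
      (\<phi> (Poly_Mapping.lookup f m) * monomial_value x m) *
      (\<phi> (Poly_Mapping.lookup g m') * monomial_value x m'))"
    using f g unfolding defined_at_def
    by (intro sum.cong refl) (simp add: monomial_value_add)
  finally show ?thesis
    by (simp add: laurent_value_def sum_product)
qed

lemma eval_laurent_eq: "eval_laurent v = laurent_value (\<lambda>c. c) (\<lambda>(i, j). v i j)"
  by (simp add: eval_laurent_def laurent_value_def monomial_value_def case_prod_unfold fun_eq_iff)

section \<open>Power series along a line\<close>

text \<open>No pole at X = 0, and value \<open>c\<close> there. Germs are kept in the field of
  Laurent series, so regularity has to be recorded separately.\<close>

definition fls_extends :: "'k::field fls \<Rightarrow> 'k \<Rightarrow> bool" where
  "fls_extends F c \<longleftrightarrow> (\<exists>G. F = fps_to_fls G \<and> fps_nth G 0 = c)"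

lemma fls_extends_const: "fls_extends (fls_const c) c"
  unfolding fls_extends_def by (intro exI[of _ "fps_const c"]) simp

lemma fls_extends_add: "fls_extends F c \<Longrightarrow> fls_extends G d \<Longrightarrow> fls_extends (F + G) (c + d)"
  unfolding fls_extends_def by (metis fps_to_fls_plus fps_add_nth)

lemma fls_extends_mult: "fls_extends F c \<Longrightarrow> fls_extends G d \<Longrightarrow> fls_extends (F * G) (c * d)"
  unfolding fls_extends_def by (metis fls_times_fps_to_fls fps_mult_nth_0)

lemma fls_extends_line: "fls_extends (fls_const c + fls_const d * fls_X) c"
  unfolding fls_extends_def
  by (intro exI[of _ "fps_const c + fps_const d * fps_X"]) (simp add: fls_times_fps_to_fls)

lemma fls_extends_one: "fls_extends 1 1"
  unfolding fls_extends_def by (intro exI[of _ 1]) simp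

lemma fls_extends_power: "fls_extends F c \<Longrightarrow> fls_extends (F ^ n) (c ^ n)"
  by (induction n) (auto intro: fls_extends_one fls_extends_mult)

lemma fls_extends_inverse:
  assumes "fls_extends F c" "c \<noteq> 0"
  shows "fls_extends (inverse F) (inverse c)"
proof -
  obtain G where G: "F = fps_to_fls G" "fps_nth G 0 = c"
    using assms unfolding fls_extends_def by blast
  then show ?thesis
    unfolding fls_extends_def using assms
    by (intro exI[of _ "inverse G"]) (auto simp: fls_inverse_fps_to_fls subdegree_eq_0)
qed

lemma fls_extends_powi:
  assumes "fls_extends F c" "e < 0 \<Longrightarrow> c \<noteq> 0"
  shows "fls_extends (F powi e) (c powi e)"
proof (cases "e \<ge> 0")
  case True
  then show ?thesis
    using assms(1) by (simp add: power_int_def fls_extends_power)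
next
  case False
  then have "fls_extends (inverse F ^ nat (- e)) (inverse c ^ nat (- e))"
    using assms by (intro fls_extends_power fls_extends_inverse) auto
  then show ?thesis
    using False by (simp add: power_int_def)
qed

lemma fls_extends_prod:
  "(\<And>t. t \<in> T \<Longrightarrow> fls_extends (F t) (c t)) \<Longrightarrow> fls_extends (\<Prod>t\<in>T. F t) (\<Prod>t\<in>T. c t)"
  by (induction T rule: infinite_finite_induct) (auto intro: fls_extends_one fls_extends_mult)

lemma fls_extends_sum:
  "(\<And>t. t \<in> T \<Longrightarrow> fls_extends (F t) (c t)) \<Longrightarrow> fls_extends (\<Sum>t\<in>T. F t) (\<Sum>t\<in>T. c t)"
  by (induction T rule: infinite_finite_induct)
    (use fls_extends_const[of 0] in \<open>auto intro: fls_extends_add\<close>)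

text \<open>The coordinates of the moving vector v + X w, in the space of homogeneous coordinates
  rather than in a chart, so that no chart has to be chosen.\<close>

definition line_germ :: "('x \<Rightarrow> 'k::field) \<Rightarrow> ('x \<Rightarrow> 'k) \<Rightarrow> 'x \<Rightarrow> 'k fls" where
  "line_germ v w k = fls_const (v k) + fls_const (w k) * fls_X"

definition restrict_to_line ::
    "('x \<Rightarrow> 'k::field) \<Rightarrow> ('x \<Rightarrow> 'k) \<Rightarrow> (('x \<Rightarrow>\<^sub>0 int) \<Rightarrow>\<^sub>0 'k) \<Rightarrow> 'k fls" where
  "restrict_to_line v w = laurent_value fls_const (line_germ v w)"

lemma restrict_to_line_extends:
  assumes "defined_at v f"
  shows "fls_extends (restrict_to_line v w f) (laurent_value (\<lambda>c. c) v f)"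
  unfolding restrict_to_line_def laurent_value_def monomial_value_def
  using assms unfolding defined_at_def monomial_defined_at_def
  by (intro fls_extends_sum fls_extends_mult fls_extends_const fls_extends_prod fls_extends_powi)
    (auto simp: line_germ_def intro: fls_extends_line)

lemma defined_at_line_germ:
  assumes "defined_at v f"
  shows "defined_at (line_germ v w) f"
proof -
  have "line_germ v w k \<noteq> 0" if "v k \<noteq> 0" for k
  proof -
    have "fls_extends (line_germ v w k) (v k)"
      unfolding line_germ_def by (rule fls_extends_line)
    then show ?thesis
      using that unfolding fls_extends_def by force
  qed
  then show ?thesis
    using assms unfolding defined_at_def monomial_defined_at_def by blast
qed

lemma restrict_to_line_mult:
  "defined_at v f \<Longrightarrow> defined_at v g \<Longrightarrow>
    restrict_to_line v w (f * g) = restrict_to_line v w f * restrict_to_line v w g"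
  unfolding restrict_to_line_def
  by (intro laurent_value_mult field_hom_fls_const defined_at_line_germ)

lemma restrict_to_line_add:
  "restrict_to_line v w (f + g) = restrict_to_line v w f + restrict_to_line v w g"
  unfolding restrict_to_line_def by (intro laurent_value_add field_hom_fls_const)

lemma restrict_to_line_sum:
  "restrict_to_line v w (\<Sum>t\<in>T. f t) = (\<Sum>t\<in>T. restrict_to_line v w (f t))"
  unfolding restrict_to_line_def by (intro laurent_value_sum field_hom_fls_const)

text \<open>Membership in the ideal generated by X^2 in the power series ring, the target of the
  square of a point ideal under restriction to a line.\<close>

definition vanishes_doubly :: "'k::field fls \<Rightarrow> bool" where
  "vanishes_doubly F \<longleftrightarrow> (\<exists>G. F = fps_to_fls G \<and> fps_nth G 0 = 0 \<and> fps_nth G 1 = 0)"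

lemma vanishes_doubly_zero: "vanishes_doubly 0"
  unfolding vanishes_doubly_def by (intro exI[of _ 0]) simp

lemma vanishes_doubly_add: "vanishes_doubly F \<Longrightarrow> vanishes_doubly G \<Longrightarrow> vanishes_doubly (F + G)"
  unfolding vanishes_doubly_def
  by (metis (no_types, opaque_lifting) add_0 fps_add_nth fps_to_fls_plus)

lemma vanishes_doubly_mult:
  assumes "fls_extends F 0" "fls_extends G 0"
  shows "vanishes_doubly (F * G)"
proof -
  obtain f g where "F = fps_to_fls f" "fps_nth f 0 = 0" "G = fps_to_fls g" "fps_nth g 0 = 0"
    using assms unfolding fls_extends_def by blast
  then show ?thesis
    unfolding vanishes_doubly_def
    by (intro exI[of _ "f * g"]) (simp add: fls_times_fps_to_fls fps_mult_nth)
qed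

lemma vanishes_doubly_mult_extends:
  assumes "vanishes_doubly F" "fls_extends G c"
  shows "vanishes_doubly (G * F)"
proof -
  obtain f g where "F = fps_to_fls f" "fps_nth f 0 = 0" "fps_nth f 1 = 0" "G = fps_to_fls g"
    using assms unfolding fls_extends_def vanishes_doubly_def by blast
  then show ?thesis
    unfolding vanishes_doubly_def
    by (intro exI[of _ "g * f"]) (simp add: fls_times_fps_to_fls fps_mult_nth)
qed

lemma vanishes_doubly_line:
  assumes "vanishes_doubly (fls_const c + fls_const d * fls_X)"
  shows "c = 0" "d = 0"
proof -
  obtain G where G: "fls_const c + fls_const d * fls_X = fps_to_fls G"
      "fps_nth G 0 = 0" "fps_nth G 1 = 0"
    using assms unfolding vanishes_doubly_def by blast
  have "fls_const c + fls_const d * fls_X = fps_to_fls (fps_const c + fps_const d * fps_X)"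
    by (simp add: fls_times_fps_to_fls)
  then have "G = fps_const c + fps_const d * fps_X"
    using G(1) by (metis fps_to_fls_eq_iff)
  then show "c = 0" "d = 0" using G by auto
qed

section \<open>Sections of line bundles and ideal sheaves\<close>

text \<open>The condition of \<open>line_bundle\<close> on a single exponent vector: line bundles
  are spanned by monomials, so membership can be checked one monomial at a time.\<close>

definition admissible :: "nat list \<Rightarrow> (nat \<Rightarrow> int) \<Rightarrow> (nat \<Rightarrow> nat) set \<Rightarrow> (nat \<times> nat \<Rightarrow>\<^sub>0 int) \<Rightarrow> bool" where
  "admissible ns d A m \<longleftrightarrow>
     (\<forall>(i, j)\<in>Poly_Mapping.keys m. i < length ns \<and> j \<le> ns ! i) \<and>
     (\<forall>i j. Poly_Mapping.lookup m (i, j) < 0 \<longrightarrow> (\<exists>a\<in>A. j = a i)) \<and>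
     (\<forall>i<length ns. (\<Sum>j\<le>ns ! i. Poly_Mapping.lookup m (i, j)) = d i)"

lemma line_bundle_iff: "f \<in> line_bundle ns d A \<longleftrightarrow> (\<forall>m\<in>Poly_Mapping.keys f. admissible ns d A m)"
  by (simp add: line_bundle_def admissible_def)

lemma admissible_add:
  assumes "admissible ns d A m" "admissible ns e A m'"
  shows "admissible ns (\<lambda>i. d i + e i) A (m + m')"
  unfolding admissible_def
proof (intro conjI allI impI)
  show "\<forall>(i, j)\<in>Poly_Mapping.keys (m + m'). i < length ns \<and> j \<le> ns ! i"
    using assms keys_add[of m m'] unfolding admissible_def by blast
next
  fix i j assume "Poly_Mapping.lookup (m + m') (i, j) < 0"
  then have "Poly_Mapping.lookup m (i, j) < 0 \<or> Poly_Mapping.lookup m' (i, j) < 0"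
    by (auto simp: lookup_add)
  then show "\<exists>a\<in>A. j = a i"
    using assms unfolding admissible_def by blast
next
  fix i assume "i < length ns"
  then show "(\<Sum>j\<le>ns ! i. Poly_Mapping.lookup (m + m') (i, j)) = d i + e i"
    using assms unfolding admissible_def by (simp add: lookup_add sum.distrib)
qed

lemma line_bundle_zero [simp]: "0 \<in> line_bundle ns d A"
  by (simp add: line_bundle_iff)

lemma line_bundle_single:
  "admissible ns d A m \<Longrightarrow> Poly_Mapping.single m c \<in> line_bundle ns d A"
  by (simp add: line_bundle_iff)

lemma line_bundle_add:
  "f \<in> line_bundle ns d A \<Longrightarrow> g \<in> line_bundle ns d A \<Longrightarrow> f + g \<in> line_bundle ns d A"
  unfolding line_bundle_iff using keys_add[of f g] by blast

lemma line_bundle_uminus: "f \<in> line_bundle ns d A \<Longrightarrow> - f \<in> line_bundle ns d A"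
  by (simp add: line_bundle_iff)

lemma line_bundle_diff:
  "f \<in> line_bundle ns d A \<Longrightarrow> g \<in> line_bundle ns d A \<Longrightarrow> f - g \<in> line_bundle ns d A"
  using line_bundle_add[of f ns d A "- g"] line_bundle_uminus[of g ns d A] by simp

lemma line_bundle_sum:
  "(\<And>t. t \<in> T \<Longrightarrow> f t \<in> line_bundle ns d A) \<Longrightarrow> (\<Sum>t\<in>T. f t) \<in> line_bundle ns d A"
  by (induction T rule: infinite_finite_induct) (auto intro: line_bundle_add)

lemma line_bundle_mult:
  assumes "f \<in> line_bundle ns d A" "g \<in> line_bundle ns e A" "\<And>i. i < length ns \<Longrightarrow> d i + e i = d' i"
  shows "f * g \<in> line_bundle ns d' A"
  unfolding line_bundle_iff
proof
  fix m assume "m \<in> Poly_Mapping.keys (f * g)"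
  then obtain a b where "m = a + b" "a \<in> Poly_Mapping.keys f" "b \<in> Poly_Mapping.keys g"
    using keys_mult[of f g] by blast
  then have "admissible ns (\<lambda>i. d i + e i) A m"
    using assms unfolding line_bundle_iff by (blast intro: admissible_add)
  then show "admissible ns d' A m"
    using assms(3) unfolding admissible_def by auto
qed

lemma line_bundle_mono: "A \<subseteq> A' \<Longrightarrow> line_bundle ns d A \<subseteq> line_bundle ns d A'"
  unfolding line_bundle_def by fastforce

lemma structure_sheaf_const: "const_laurent c \<in> structure_sheaf ns A"
  by (simp add: structure_sheaf_def const_laurent_def line_bundle_single admissible_def)

lemma structure_sheaf_zero [simp]: "0 \<in> structure_sheaf ns A"
  by (simp add: structure_sheaf_def)

lemma structure_sheaf_one: "1 \<in> structure_sheaf ns A"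
  using structure_sheaf_const[of 1] by (simp add: const_laurent_def)

lemma structure_sheaf_add:
  "f \<in> structure_sheaf ns A \<Longrightarrow> g \<in> structure_sheaf ns A \<Longrightarrow> f + g \<in> structure_sheaf ns A"
  by (simp add: structure_sheaf_def line_bundle_add)

lemma structure_sheaf_diff:
  "f \<in> structure_sheaf ns A \<Longrightarrow> g \<in> structure_sheaf ns A \<Longrightarrow> f - g \<in> structure_sheaf ns A"
  by (simp add: structure_sheaf_def line_bundle_diff)

lemma structure_sheaf_mult:
  "f \<in> structure_sheaf ns A \<Longrightarrow> g \<in> structure_sheaf ns A \<Longrightarrow> f * g \<in> structure_sheaf ns A"
  unfolding structure_sheaf_def by (rule line_bundle_mult) auto

lemma structure_sheaf_line_bundle_mult:
  "f \<in> structure_sheaf ns A \<Longrightarrow> g \<in> line_bundle ns d A \<Longrightarrow> f * g \<in> line_bundle ns d A"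
  unfolding structure_sheaf_def by (rule line_bundle_mult) auto

lemma const_laurent_line_bundle:
  "g \<in> line_bundle ns d A \<Longrightarrow> const_laurent c * g \<in> line_bundle ns d A"
  using structure_sheaf_const by (rule structure_sheaf_line_bundle_mult)

lemma const_laurent_hom:
  "const_laurent (a + b) = const_laurent a + const_laurent b"
  "const_laurent (a - b) = const_laurent a - const_laurent b"
  "const_laurent (a * b) = const_laurent a * const_laurent b"
  "const_laurent (0 :: 'k::field) = 0" "const_laurent (1 :: 'k) = 1"
  by (simp_all add: const_laurent_def single_add single_diff mult_single)

lemma const_laurent_sum: "const_laurent (\<Sum>t\<in>T. c t) = (\<Sum>t\<in>T. const_laurent (c t :: 'k::field))"
  by (induction T rule: infinite_finite_induct) (simp_all add: const_laurent_hom)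

section \<open>Closure and induction for finite sums of products\<close>

lemma module_product_add:
  assumes "x \<in> module_product I M" "y \<in> module_product I M"
  shows "x + y \<in> module_product I M"
proof -
  obtain N f g where 1: "x = (\<Sum>t<(N::nat). f t * g t)" "\<And>t. t < N \<Longrightarrow> f t \<in> I \<and> g t \<in> M"
    using assms(1) unfolding module_product_def by blast
  obtain N' f' g' where 2: "y = (\<Sum>t<(N'::nat). f' t * g' t)" "\<And>t. t < N' \<Longrightarrow> f' t \<in> I \<and> g' t \<in> M"
    using assms(2) unfolding module_product_def by blast
  define F where "F t = (if t < N then f t else f' (t - N))" for t
  define G where "G t = (if t < N then g t else g' (t - N))" for t
  have "(\<Sum>t<N + M. F t * G t) = x + (\<Sum>t<M. f' t * g' t)" for M
  proof (induction M)
    case 0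
    then show ?case by (simp add: 1 F_def G_def)
  qed (simp add: F_def G_def algebra_simps)
  then have "x + y = (\<Sum>t<N + N'. F t * G t)"
    by (simp add: 2)
  moreover have "F t \<in> I \<and> G t \<in> M" if "t < N + N'" for t
    using that 1 2 by (auto simp: F_def G_def)
  ultimately show ?thesis
    unfolding module_product_def by blast
qed

lemma module_product_zero: "0 \<in> module_product I M"
  unfolding module_product_def by (force intro!: exI[of _ 0])

lemma module_product_mult:
  assumes "x \<in> I" "y \<in> M"
  shows "x * y \<in> module_product I M"
  unfolding module_product_def
  using assms by (intro CollectI exI[of _ 1] exI[of _ "\<lambda>_. x"] exI[of _ "\<lambda>_. y"]) auto

lemma module_product_induct [consumes 1, case_names zero mult add]:
  assumes "z \<in> module_product I M" "P 0" "\<And>x y. x \<in> I \<Longrightarrow> y \<in> M \<Longrightarrow> P (x * y)"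
    and "\<And>x y. P x \<Longrightarrow> P y \<Longrightarrow> P (x + y)"
  shows "P z"
proof -
  obtain N f g where z: "z = (\<Sum>t<(N::nat). f t * g t)" "\<forall>t<N. f t \<in> I \<and> g t \<in> M"
    using assms(1) unfolding module_product_def by blast
  have "P (\<Sum>t<N'. f t * g t)" if "N' \<le> N" for N'
    using that
  proof (induction N')
    case (Suc N')
    then show ?case
      using z(2) assms(3)[of "f N'" "g N'"] assms(4)[of "\<Sum>t<N'. f t * g t" "f N' * g N'"] by simp
  qed (simp add: assms(2))
  then show ?thesis using z(1) by simp
qed

lemma module_product_mono: "I \<subseteq> I' \<Longrightarrow> M \<subseteq> M' \<Longrightarrow> module_product I M \<subseteq> module_product I' M'"
  by (intro subsetI, erule module_product_induct)
    (auto intro: module_product_mult module_product_zero module_product_add)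

section \<open>Points and their representatives\<close>

lemma proj_space_rep:
  assumes "P \<in> proj_space m"
  obtains v where "v \<in> nonzero_vectors m" "v \<in> P" "P = {\<lambda>j. c * v j | c. c \<noteq> 0}"
proof -
  obtain v where v: "v \<in> nonzero_vectors m" "P = proportional m `` {v}"
    using assms unfolding proj_space_def by (auto elim: quotientE)
  have "P = {\<lambda>j. c * v j | c. c \<noteq> 0}"
    using v by (auto simp: proportional_def nonzero_vectors_def)
  moreover have "v \<in> {\<lambda>j. c * v j | c. c \<noteq> 0}"
    by (auto intro: exI[of _ 1])
  ultimately show ?thesis using that v by blast
qed

lemma proj_space_scaled:
  assumes "P \<in> proj_space m" "v \<in> P" "w \<in> P"
  obtains c where "c \<noteq> 0" "w = (\<lambda>j. c * v j)"
proof -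
  obtain u where u: "P = {\<lambda>j. c * u j | c. c \<noteq> 0}"
    using assms(1) by (rule proj_space_rep)
  then obtain b c where "b \<noteq> 0" "v = (\<lambda>j. b * u j)" "c \<noteq> 0" "w = (\<lambda>j. c * u j)"
    using assms by blast
  then show ?thesis
    by (intro that[of "c / b"]) auto
qed

lemma proj_space_nonzero:
  assumes "P \<in> proj_space m" "v \<in> P"
  shows "\<exists>j\<le>m. v j \<noteq> 0" "j > m \<Longrightarrow> v j = 0"
proof -
  obtain u where u: "u \<in> nonzero_vectors m" "P = {\<lambda>j. c * u j | c. c \<noteq> 0}"
    using assms(1) by (rule proj_space_rep)
  then show "\<exists>j\<le>m. v j \<noteq> 0"
    using assms(2) by (auto simp: nonzero_vectors_def) (metis linorder_not_less)
  show "j > m \<Longrightarrow> v j = 0"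
    using assms(2) u by (auto simp: nonzero_vectors_def)
qed

lemma proj_space_eqI:
  assumes "P \<in> proj_space m" "Q \<in> proj_space m" "v \<in> P" "w \<in> Q" "c \<noteq> 0" "w = (\<lambda>j. c * v j)"
  shows "P = Q"
proof -
  obtain u where u: "P = {\<lambda>j. c * u j | c. c \<noteq> 0}"
    using assms(1) by (rule proj_space_rep)
  obtain u' where u': "Q = {\<lambda>j. c * u' j | c. c \<noteq> 0}"
    using assms(2) by (rule proj_space_rep)
  obtain b where b: "v = (\<lambda>j. b * u j)" "b \<noteq> 0" using assms u by blast
  obtain b' where b': "w = (\<lambda>j. b' * u' j)" "b' \<noteq> 0" using assms u' by blast
  have eq: "u' = (\<lambda>j. (c * b / b') * u j)"
  proof
    fix j
    have "b' * u' j = c * (b * u j)" using b b' assms(6) by metis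
    then show "u' j = (c * b / b') * u j" using b' by (simp add: field_simps)
  qed
  have "c * b / b' \<noteq> 0" using assms b b' by simp
  then show ?thesis
    unfolding u u' eq
    apply (auto simp flip: mult.assoc)
    subgoal for d by (rule exI[of _ "d / (c * b / b')"]) auto
    subgoal for d by (rule exI[of _ "d * (c * b / b')"]) auto
    done
qed

definition representative :: "nat list \<Rightarrow> (nat \<Rightarrow> (nat \<Rightarrow> 'k) set) \<Rightarrow> (nat \<Rightarrow> nat \<Rightarrow> 'k) \<Rightarrow> bool" where
  "representative ns p v \<longleftrightarrow> (\<forall>i<length ns. v i \<in> p i)"

lemma multiproj_space_nth: "p \<in> multiproj_space ns \<Longrightarrow> i < length ns \<Longrightarrow> p i \<in> proj_space (ns ! i)"
  unfolding multiproj_space_def by auto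

lemma representative_exists:
  assumes "p \<in> multiproj_space ns"
  obtains v where "representative ns p v"
proof -
  have "\<forall>i<length ns. \<exists>v. v \<in> p i"
    using multiproj_space_nth[OF assms] proj_space_rep by metis
  then show ?thesis using that unfolding representative_def by metis
qed

lemma representative_scaled:
  assumes "p \<in> multiproj_space ns" "representative ns p v" "representative ns p w" "i < length ns"
  obtains c where "c \<noteq> 0" "w i = (\<lambda>j. c * v i j)"
  using proj_space_scaled[OF multiproj_space_nth[OF assms(1,4)], of "v i" "w i"] assms
  unfolding representative_def by metis

lemma chart_points_iff:
  assumes "p \<in> multiproj_space ns" "representative ns p v"
  shows "p \<in> chart_points ns A \<longleftrightarrow> (\<forall>a\<in>A. \<forall>i<length ns. v i (a i) \<noteq> 0)"
proof
  assume "p \<in> chart_points ns A"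
  then show "\<forall>a\<in>A. \<forall>i<length ns. v i (a i) \<noteq> 0"
    using assms(2) unfolding chart_points_def representative_def by blast
next
  assume v: "\<forall>a\<in>A. \<forall>i<length ns. v i (a i) \<noteq> 0"
  have "w (a i) \<noteq> 0" if aiw: "a \<in> A" "i < length ns" "w \<in> p i" for a i w
  proof -
    obtain c where "c \<noteq> 0" "w = (\<lambda>j. c * v i j)"
      using proj_space_scaled[OF multiproj_space_nth[OF assms(1) aiw(2)] _ aiw(3), of "v i"]
        assms(2) aiw(2) unfolding representative_def by metis
    then show ?thesis using v aiw by simp
  qed
  then show "p \<in> chart_points ns A"
    using assms(1) unfolding chart_points_def by blast
qed

lemma chart_exists:
  assumes "p \<in> multiproj_space ns"
  obtains a where "a \<in> charts ns" "p \<in> chart_points ns {a}"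
proof -
  obtain v where v: "representative ns p v" using assms by (rule representative_exists)
  have "\<forall>i<length ns. \<exists>j\<le>ns ! i. v i j \<noteq> 0"
    using proj_space_nonzero(1)[OF multiproj_space_nth[OF assms]] v
    unfolding representative_def by blast
  then obtain a where a: "\<And>i. i < length ns \<Longrightarrow> a i \<le> ns ! i \<and> v i (a i) \<noteq> 0" by metis
  show ?thesis
    by (rule that[of "restrict a {..<length ns}"])
      (use a chart_points_iff[OF assms v] in \<open>auto simp: charts_def\<close>)
qed

lemma chart_points_insert:
  "p \<in> chart_points ns (insert a A) \<longleftrightarrow> p \<in> chart_points ns {a} \<and> p \<in> chart_points ns A"
  unfolding chart_points_def by auto

text \<open>In a factor where the points differ, the coordinate vectors are not proportional. If all
  2x2 minors through a column \<open>b\<close> with \<open>v i b \<noteq> 0\<close> vanished,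
  \<open>w i\<close> would be a multiple of \<open>v i\<close>. Stating this with minors allows
  \<open>w i b\<close> to be zero, and \<open>b\<close> is quantified after \<open>i\<close> so that
  a chart of \<open>p\<close> may supply it.\<close>

lemma separating_coordinate:
  assumes "p \<in> multiproj_space ns" "q \<in> multiproj_space ns" "p \<noteq> q"
    and v: "representative ns p v" and w: "representative ns q w"
  obtains i where "i < length ns"
    "\<And>b. v i b \<noteq> 0 \<Longrightarrow> \<exists>j\<le>ns ! i. v i b * w i j \<noteq> v i j * w i b"
proof -
  obtain i where i: "i < length ns" "p i \<noteq> q i"
    using assms(1-3) unfolding multiproj_space_def by (metis PiE_ext lessThan_iff)
  have P: "p i \<in> proj_space (ns ! i)" "q i \<in> proj_space (ns ! i)" "v i \<in> p i" "w i \<in> q i"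
    using assms i multiproj_space_nth unfolding representative_def by blast+
  have "\<exists>j\<le>ns ! i. v i b * w i j \<noteq> v i j * w i b" if b: "v i b \<noteq> 0" for b
  proof (rule ccontr)
    assume neg: "\<not> ?thesis"
    have eq: "w i j = (w i b / v i b) * v i j" for j
    proof (cases "j \<le> ns ! i")
      case True
      then show ?thesis using neg b by (simp add: field_simps)
    next
      case False
      then have "v i j = 0" "w i j = 0"
        using proj_space_nonzero(2)[OF P(1,3)] proj_space_nonzero(2)[OF P(2,4)] by simp_all
      then show ?thesis by simp
    qed
    have "w i b / v i b \<noteq> 0"
      using eq proj_space_nonzero(1)[OF P(2,4)] by force
    then have "p i = q i"
      using proj_space_eqI[OF P] eq by blast
    then show False using i by simp
  qed
  then show ?thesis using that i by blast
qed

section \<open>Ideals of points and double points\<close>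

abbreviation coords :: "(nat \<Rightarrow> nat \<Rightarrow> 'k) \<Rightarrow> nat \<times> nat \<Rightarrow> 'k" where
  "coords v \<equiv> \<lambda>(i, j). v i j"

lemma defined_at_representative:
  assumes "p \<in> chart_points ns A" "representative ns p v" "f \<in> line_bundle ns d A"
  shows "defined_at (coords v) f"
proof -
  have p: "p \<in> multiproj_space ns" using assms(1) by (simp add: chart_points_def)
  have nz: "\<forall>a\<in>A. \<forall>i<length ns. v i (a i) \<noteq> 0"
    using chart_points_iff[OF p assms(2)] assms(1) by blast
  have "v i j \<noteq> 0" if "m \<in> Poly_Mapping.keys f" "Poly_Mapping.lookup m (i, j) < 0" for m i j
  proof -
    have adm: "admissible ns d A m" using assms(3) that unfolding line_bundle_iff by blast
    have "(i, j) \<in> Poly_Mapping.keys m" using that by (simp add: in_keys_iff)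
    then have "i < length ns" using adm unfolding admissible_def by blast
    moreover have "\<exists>a\<in>A. j = a i"
      using adm that(2) unfolding admissible_def by blast
    ultimately show ?thesis using nz by blast
  qed
  then show ?thesis
    unfolding defined_at_def monomial_defined_at_def by auto
qed

abbreviation value_at :: "(nat \<Rightarrow> nat \<Rightarrow> 'k::field) \<Rightarrow> 'k laurent \<Rightarrow> 'k" where
  "value_at v \<equiv> laurent_value (\<lambda>c. c) (coords v)"

lemma value_at_add: "value_at v (f + g) = value_at v f + value_at v g"
  by (rule laurent_value_add[OF field_hom_id])

lemma value_at_const [simp]: "value_at v (const_laurent c) = c"
  by (simp add: const_laurent_def laurent_value_single[OF field_hom_id])

lemma value_at_diff: "value_at v (f - g) = value_at v f - value_at v g"
  using value_at_add[of v "f - g" g] by simp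

lemma value_at_mult:
  assumes "p \<in> chart_points ns A" "representative ns p v"
    "f \<in> line_bundle ns d A" "g \<in> line_bundle ns e A"
  shows "value_at v (f * g) = value_at v f * value_at v g"
  using assms by (intro laurent_value_mult field_hom_id defined_at_representative)

lemma point_ideal_iff:
  "f \<in> point_ideal_sheaf ns p A \<longleftrightarrow> f \<in> structure_sheaf ns A \<and>
     (p \<in> chart_points ns A \<longrightarrow> (\<forall>v. representative ns p v \<longrightarrow> value_at v f = 0))"
  by (simp add: point_ideal_sheaf_def representative_def eval_laurent_eq)

lemma point_ideal_mult:
  assumes "f \<in> structure_sheaf ns A" "g \<in> point_ideal_sheaf ns p A"
  shows "f * g \<in> point_ideal_sheaf ns p A"
proof -
  have "value_at v (f * g) = 0" if "p \<in> chart_points ns A" "representative ns p v" for v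
    using assms that value_at_mult[OF that, of f "\<lambda>_. 0" g "\<lambda>_. 0"]
    by (simp add: point_ideal_iff structure_sheaf_def)
  then show ?thesis
    using assms by (auto simp: point_ideal_iff structure_sheaf_mult)
qed

lemma point_ideal_mono:
  assumes "A \<subseteq> A'"
  shows "point_ideal_sheaf ns p A \<subseteq> point_ideal_sheaf ns p A'"
proof
  fix f assume f: "f \<in> point_ideal_sheaf ns p A"
  have "p \<in> chart_points ns A" if "p \<in> chart_points ns A'"
    using that assms unfolding chart_points_def by blast
  then show "f \<in> point_ideal_sheaf ns p A'"
    using f line_bundle_mono[OF assms] unfolding point_ideal_iff structure_sheaf_def by blast
qed

lemma double_point_ideal_mult:
  assumes "f \<in> structure_sheaf ns A" "g \<in> double_point_ideal_sheaf ns p A"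
  shows "f * g \<in> double_point_ideal_sheaf ns p A"
  using assms(2) unfolding double_point_ideal_sheaf_def
proof (induction rule: module_product_induct)
  case (mult x y)
  then have "f * x * y \<in> module_product (point_ideal_sheaf ns p A) (point_ideal_sheaf ns p A)"
    using assms(1) by (intro module_product_mult point_ideal_mult)
  then show ?case by (simp add: mult.assoc)
qed (auto simp: distrib_left module_product_zero module_product_add)

lemma double_point_ideal_add:
  "f \<in> double_point_ideal_sheaf ns p A \<Longrightarrow> g \<in> double_point_ideal_sheaf ns p A \<Longrightarrow>
    f + g \<in> double_point_ideal_sheaf ns p A"
  unfolding double_point_ideal_sheaf_def by (rule module_product_add)

lemma double_point_ideal_zero: "0 \<in> double_point_ideal_sheaf ns p A"
  unfolding double_point_ideal_sheaf_def by (rule module_product_zero)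

lemma double_point_ideal_const:
  "f \<in> double_point_ideal_sheaf ns p A \<Longrightarrow> const_laurent c * f \<in> double_point_ideal_sheaf ns p A"
  by (rule double_point_ideal_mult[OF structure_sheaf_const])

lemma double_point_ideal_diff:
  assumes "f \<in> double_point_ideal_sheaf ns p A" "g \<in> double_point_ideal_sheaf ns p A"
  shows "f - g \<in> double_point_ideal_sheaf ns p A"
proof -
  have "f + const_laurent (- 1) * g \<in> double_point_ideal_sheaf ns p A"
    using assms by (intro double_point_ideal_add double_point_ideal_const)
  moreover have "const_laurent (- 1) = (- 1 :: 'a laurent)"
    by (simp add: const_laurent_def single_uminus)
  ultimately show ?thesis by simp
qed

lemma double_point_ideal_sum:
  "(\<And>t. t \<in> T \<Longrightarrow> f t \<in> double_point_ideal_sheaf ns p A) \<Longrightarrow>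
    (\<Sum>t\<in>T. f t) \<in> double_point_ideal_sheaf ns p A"
  by (induction T rule: infinite_finite_induct)
    (auto intro: double_point_ideal_add double_point_ideal_zero)

lemma double_point_ideal_mono:
  "A \<subseteq> A' \<Longrightarrow> double_point_ideal_sheaf ns p A \<subseteq> double_point_ideal_sheaf ns p A'"
  unfolding double_point_ideal_sheaf_def by (intro module_product_mono point_ideal_mono)

lemma double_point_ideal_intro:
  "f \<in> point_ideal_sheaf ns p A \<Longrightarrow> g \<in> point_ideal_sheaf ns p A \<Longrightarrow>
    f * g \<in> double_point_ideal_sheaf ns p A"
  unfolding double_point_ideal_sheaf_def by (rule module_product_mult)

lemma double_point_ideal_subset: "double_point_ideal_sheaf ns p A \<subseteq> structure_sheaf ns A"
proof
  fix f assume "f \<in> double_point_ideal_sheaf ns p A"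
  then show "f \<in> structure_sheaf ns A"
    unfolding double_point_ideal_sheaf_def
    by (induction rule: module_product_induct)
      (simp_all add: point_ideal_iff structure_sheaf_mult structure_sheaf_add)
qed

text \<open>Away from \<open>p\<close> the point ideal contains 1, hence so does its square.\<close>

lemma double_point_ideal_outside:
  assumes "p \<notin> chart_points ns A"
  shows "double_point_ideal_sheaf ns p A = structure_sheaf ns A"
proof
  have "f \<in> double_point_ideal_sheaf ns p A" if "f \<in> structure_sheaf ns A" for f
  proof -
    have "f * 1 \<in> double_point_ideal_sheaf ns p A"
      using assms that by (intro double_point_ideal_intro) (auto simp: point_ideal_iff structure_sheaf_one)
    then show ?thesis by simp
  qed
  then show "structure_sheaf ns A \<subseteq> double_point_ideal_sheaf ns p A" by blast
qed (rule double_point_ideal_subset)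

text \<open>Each factor of a product restricts to a power series with constant term 0. This is the
  only tool in the proof for showing that a function is not in the square of the ideal.\<close>

lemma double_point_ideal_vanishes_doubly:
  assumes "p \<in> chart_points ns A" "representative ns p v" "f \<in> double_point_ideal_sheaf ns p A"
  shows "vanishes_doubly (restrict_to_line (coords v) w f)"
  using assms(3) unfolding double_point_ideal_sheaf_def
proof (induction rule: module_product_induct)
  case zero
  then show ?case by (simp add: restrict_to_line_def vanishes_doubly_zero)
next
  case (mult x y)
  have *: "defined_at (coords v) z" "fls_extends (restrict_to_line (coords v) w z) 0"
    if "z \<in> point_ideal_sheaf ns p A" for z
  proof -
    show "defined_at (coords v) z"
      using that assms defined_at_representative unfolding point_ideal_iff structure_sheaf_def by blast
    then show "fls_extends (restrict_to_line (coords v) w z) 0"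
      using restrict_to_line_extends[of "coords v" z w] that assms(1,2) by (simp add: point_ideal_iff)
  qed
  show ?case
    using mult * by (simp add: restrict_to_line_mult vanishes_doubly_mult)
next
  case (add x y)
  then show ?case by (simp add: restrict_to_line_add vanishes_doubly_add)
qed

section \<open>Local coordinates in a chart\<close>

text \<open>The exponent of the product of the selected variables, one from each factor. This
  monomial generates the line bundle of multidegree (1,...,1) on the chart; multiplying by its
  inverse turns sections into functions.\<close>

definition chart_weight :: "nat list \<Rightarrow> (nat \<Rightarrow> nat) \<Rightarrow> (nat \<times> nat \<Rightarrow>\<^sub>0 int)" where
  "chart_weight ns a = (\<Sum>i<length ns. Poly_Mapping.single (i, a i) 1)"

definition chart_section :: "nat list \<Rightarrow> (nat \<Rightarrow> nat) \<Rightarrow> 'k::field laurent" where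
  "chart_section ns a = Poly_Mapping.single (chart_weight ns a) 1"

definition chart_section_inv :: "nat list \<Rightarrow> (nat \<Rightarrow> nat) \<Rightarrow> 'k::field laurent" where
  "chart_section_inv ns a = Poly_Mapping.single (- chart_weight ns a) 1"

definition coord_ratio :: "(nat \<Rightarrow> nat) \<Rightarrow> nat \<Rightarrow> nat \<Rightarrow> 'k::field laurent" where
  "coord_ratio a i j =
     Poly_Mapping.single (Poly_Mapping.single (i, j) 1 - Poly_Mapping.single (i, a i) 1) 1"

text \<open>\<open>None\<close> stands for the constant function, \<open>Some (i, j)\<close> for an
  affine coordinate of the chart. The coordinates are not centred at the point: together with
  constants they span the same space as centred ones, so one basis serves all points of a
  chart.\<close>

definition jet_index :: "nat list \<Rightarrow> (nat \<Rightarrow> nat) \<Rightarrow> (nat \<times> nat) option set" where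
  "jet_index ns a = insert None (Some ` (SIGMA i:{..<length ns}. {..ns ! i} - {a i}))"

definition jet_basis :: "(nat \<Rightarrow> nat) \<Rightarrow> (nat \<times> nat) option \<Rightarrow> 'k::field laurent" where
  "jet_basis a t = (case t of None \<Rightarrow> 1 | Some (i, j) \<Rightarrow> coord_ratio a i j)"

lemma chart_le: "a \<in> charts ns \<Longrightarrow> i < length ns \<Longrightarrow> a i \<le> ns ! i"
  unfolding charts_def by auto

lemma lookup_chart_weight:
  "Poly_Mapping.lookup (chart_weight ns a) (i, j) = (if i < length ns \<and> j = a i then 1 else 0)"
proof -
  have "Poly_Mapping.lookup (chart_weight ns a) (i, j) =
      (\<Sum>i'<length ns. if i' = i then (if j = a i then 1 else 0) else 0)"
    unfolding chart_weight_def lookup_sum lookup_single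
    by (intro sum.cong) (auto simp: when_def)
  then show ?thesis by simp
qed

lemma admissible_chart_weight:
  assumes "a \<in> charts ns"
  shows "admissible ns (\<lambda>_. 1) A (chart_weight ns a)"
  using chart_le[OF assms] unfolding admissible_def
  by (auto simp: in_keys_iff lookup_chart_weight split: if_splits)

lemma admissible_chart_weight_uminus:
  assumes "a \<in> charts ns" "a \<in> A"
  shows "admissible ns (\<lambda>_. - 1) A (- chart_weight ns a)"
  using chart_le[OF assms(1)] assms(2) unfolding admissible_def
  by (auto simp: in_keys_iff lookup_chart_weight sum_negf split: if_splits)

lemma chart_section_line_bundle:
  "a \<in> charts ns \<Longrightarrow> chart_section ns a \<in> line_bundle ns (\<lambda>_. 1) A"
  unfolding chart_section_def by (intro line_bundle_single admissible_chart_weight)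

lemma chart_section_inv_line_bundle:
  "a \<in> charts ns \<Longrightarrow> a \<in> A \<Longrightarrow> chart_section_inv ns a \<in> line_bundle ns (\<lambda>_. - 1) A"
  unfolding chart_section_inv_def by (intro line_bundle_single admissible_chart_weight_uminus)

lemma chart_section_inverse [simp]:
  "chart_section_inv ns a * chart_section ns a = 1"
  "chart_section ns a * chart_section_inv ns a = 1"
  by (simp_all add: chart_section_def chart_section_inv_def mult_single)

lemma chart_section_inv_mult:
  assumes "a \<in> charts ns" "a \<in> A" "f \<in> line_bundle ns (\<lambda>_. 1) A"
  shows "chart_section_inv ns a * f \<in> structure_sheaf ns A"
  unfolding structure_sheaf_def
  using line_bundle_mult[OF chart_section_inv_line_bundle[OF assms(1,2)] assms(3)] by simp

lemma coord_ratio_structure_sheaf: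
  assumes "a \<in> charts ns" "a \<in> A" "i < length ns" "j \<le> ns ! i"
  shows "coord_ratio a i j \<in> structure_sheaf ns A"
  unfolding coord_ratio_def structure_sheaf_def
proof (rule line_bundle_single)
  let ?m = "Poly_Mapping.single (i, j) 1 - Poly_Mapping.single (i, a i) 1 :: nat \<times> nat \<Rightarrow>\<^sub>0 int"
  have lk: "Poly_Mapping.lookup ?m (i', j') =
      (if i' = i then (if j' = j then 1 else 0) - (if j' = a i then 1 else 0) else 0)" for i' j'
    by (auto simp: lookup_minus lookup_single when_def)
  show "admissible ns (\<lambda>_. 0) A ?m"
    unfolding admissible_def
  proof (intro conjI allI impI)
    show "\<forall>(i, j)\<in>Poly_Mapping.keys ?m. i < length ns \<and> j \<le> ns ! i"
      using assms chart_le[OF assms(1)] by (auto simp: in_keys_iff lk split: if_splits)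
    show "\<exists>a\<in>A. j' = a i'" if "Poly_Mapping.lookup ?m (i', j') < 0" for i' j'
      using that assms(2) unfolding lk by (auto split: if_splits)
    show "(\<Sum>j'\<le>ns ! i'. Poly_Mapping.lookup ?m (i', j')) = 0" if "i' < length ns" for i'
    proof (cases "i' = i")
      case True
      then show ?thesis
        using assms(4) chart_le[OF assms(1) that] by (simp add: lk sum_subtractf)
    qed (simp add: lk)
  qed
qed

lemma finite_jet_index: "finite (jet_index ns a)"
  unfolding jet_index_def by auto

lemma card_jet_index:
  assumes "a \<in> charts ns"
  shows "card (jet_index ns a) = sum_list ns + 1"
proof -
  have "card (SIGMA i:{..<length ns}. {..ns ! i} - {a i}) = (\<Sum>i<length ns. card ({..ns ! i} - {a i}))"
    by (rule card_SigmaI) auto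
  also have "\<dots> = (\<Sum>i<length ns. ns ! i)"
    using chart_le[OF assms] by (intro sum.cong refl) simp
  also have "\<dots> = sum_list ns"
    by (simp add: sum_list_sum_nth atLeast0LessThan)
  finally show ?thesis
    unfolding jet_index_def by (subst card_insert_disjoint) (auto simp: card_image)
qed

lemma jet_basis_structure_sheaf:
  assumes "a \<in> charts ns" "a \<in> A" "t \<in> jet_index ns a"
  shows "jet_basis a t \<in> structure_sheaf ns A"
  using assms unfolding jet_index_def jet_basis_def
  by (auto intro: structure_sheaf_one coord_ratio_structure_sheaf)

lemma monomial_value_ratio:
  assumes "x k' \<noteq> 0"
  shows "monomial_value x (Poly_Mapping.single k 1 - Poly_Mapping.single k' 1) = x k / x k'"
proof -
  have "monomial_value x (Poly_Mapping.single k 1 + Poly_Mapping.single k' (- 1)) = x k / x k'"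
    using assms
    by (subst monomial_value_add)
      (auto simp: monomial_defined_at_def lookup_single when_def monomial_value_single
        power_int_minus field_simps)
  then show ?thesis by (simp add: single_uminus)
qed

lemma coord_ratio_point_ideal:
  assumes "a \<in> charts ns" "a \<in> A" "i < length ns" "j \<le> ns ! i"
    and p: "p \<in> chart_points ns A" and v: "representative ns p v"
  shows "coord_ratio a i j - const_laurent (v i j / v i (a i)) \<in> point_ideal_sheaf ns p A"
proof -
  have pm: "p \<in> multiproj_space ns" using p by (simp add: chart_points_def)
  have "value_at w (coord_ratio a i j - const_laurent (v i j / v i (a i))) = 0"
    if w: "representative ns p w" for w
  proof -
    obtain c where c: "c \<noteq> 0" "w i = (\<lambda>j. c * v i j)"
      using representative_scaled[OF pm v w assms(3)] .
    have "v i (a i) \<noteq> 0"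
      using chart_points_iff[OF pm v] p assms by blast
    then show ?thesis
      using c by (simp add: value_at_diff coord_ratio_def laurent_value_single[OF field_hom_id]
          monomial_value_ratio)
  qed
  then show ?thesis
    using assms unfolding point_ideal_iff
    by (auto intro: structure_sheaf_diff coord_ratio_structure_sheaf structure_sheaf_const)
qed

section \<open>First-order jets modulo the square of a point ideal\<close>

definition jet :: "nat list \<Rightarrow> (nat \<Rightarrow> nat) \<Rightarrow> ((nat \<times> nat) option \<Rightarrow> 'k) \<Rightarrow> 'k::field laurent" where
  "jet ns a c = (\<Sum>t\<in>jet_index ns a. const_laurent (c t) * jet_basis a t)"

lemma jet_add: "jet ns a (\<lambda>t. c t + d t) = jet ns a c + jet ns a d"
  by (simp add: jet_def const_laurent_hom distrib_right sum.distrib)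

lemma jet_scale: "jet ns a (\<lambda>t. b * c t) = const_laurent b * jet ns a c"
  by (simp add: jet_def const_laurent_hom sum_distrib_left mult.assoc)

lemma jet_sum: "jet ns a (\<lambda>t. \<Sum>x\<in>X. c x t) = (\<Sum>x\<in>X. jet ns a (c x))"
proof -
  have "jet ns a (\<lambda>t. \<Sum>x\<in>X. c x t) =
      (\<Sum>t\<in>jet_index ns a. \<Sum>x\<in>X. const_laurent (c x t) * jet_basis a t)"
    by (simp add: jet_def const_laurent_sum sum_distrib_right)
  also have "\<dots> = (\<Sum>x\<in>X. jet ns a (c x))"
    unfolding jet_def by (rule sum.swap)
  finally show ?thesis .
qed

lemma jet_single:
  assumes "t \<in> jet_index ns a"
  shows "jet ns a (\<lambda>s. if s = t then 1 else 0) = jet_basis a t"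
proof -
  have "jet ns a (\<lambda>s. if s = t then 1 else 0) = (\<Sum>s\<in>jet_index ns a. if s = t then jet_basis a t else 0)"
    unfolding jet_def by (intro sum.cong) (auto simp: const_laurent_hom)
  then show ?thesis using assms finite_jet_index by simp
qed

text \<open>
  Modulo the square of the ideal of \<open>p\<close>, a product of two coordinates \<open>z\<close>, \<open>z'\<close> with values \<open>c\<close>, \<open>c'\<close>
  at \<open>p\<close> is \<open>c z' + c' z - c c'\<close>, so every monomial reduces to degree at most one.
\<close>

lemma taylor_expansion:
  assumes a: "a \<in> charts ns" and p: "p \<in> chart_points ns {a}" and u: "u \<in> structure_sheaf ns {a}"
  obtains c where "u - jet ns a c \<in> double_point_ideal_sheaf ns p {a}"
proof -
  define J where "J = double_point_ideal_sheaf ns p {a}"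
  define Tay where "Tay u \<longleftrightarrow> (\<exists>c. u - jet ns a c \<in> J)" for u
  have Tay_add: "Tay (u + u')" if Tu: "Tay u" "Tay u'" for u u'
  proof -
    obtain c c' where "u - jet ns a c \<in> J" "u' - jet ns a c' \<in> J" using Tu Tay_def by blast
    then have "(u - jet ns a c) + (u' - jet ns a c') \<in> J"
      unfolding J_def by (rule double_point_ideal_add)
    then have "(u + u') - jet ns a (\<lambda>t. c t + c' t) \<in> J"
      by (simp add: jet_add algebra_simps)
    then show ?thesis unfolding Tay_def by blast
  qed
  have Tay_scale: "Tay (const_laurent b * u)" if Tu: "Tay u" for u b
  proof -
    obtain c where "u - jet ns a c \<in> J" using Tu Tay_def by blast
    then have "const_laurent b * (u - jet ns a c) \<in> J"
      unfolding J_def by (rule double_point_ideal_const)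
    then have "const_laurent b * u - jet ns a (\<lambda>t. b * c t) \<in> J"
      by (simp add: jet_scale algebra_simps)
    then show ?thesis unfolding Tay_def by blast
  qed
  have Tay_J: "Tay u" if "u \<in> J" for u
    unfolding Tay_def using that
    by (intro exI[of _ "\<lambda>_. 0"]) (simp add: jet_def const_laurent_hom)
  have zero: "Tay 0"
    by (rule Tay_J) (simp add: J_def double_point_ideal_zero)
  have Tay_basis: "Tay (jet_basis a t)" if "t \<in> jet_index ns a" for t
    unfolding Tay_def using that
    by (intro exI[of _ "\<lambda>s. if s = t then 1 else 0"])
      (simp add: jet_single J_def double_point_ideal_zero)
  have Tay_sum: "Tay (\<Sum>x\<in>X. f x)" if "\<And>x. x \<in> X \<Longrightarrow> Tay (f x)"
      for X :: "(nat \<times> nat \<Rightarrow>\<^sub>0 int) set" and f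
    using that
  proof (induction X rule: infinite_finite_induct)
    case (insert x X)
    then show ?case by (simp add: Tay_add)
  qed (use zero in auto)
  have one: "Tay 1"
    using Tay_basis[of None] by (simp add: jet_index_def jet_basis_def)
  obtain v where v: "representative ns p v"
    using p representative_exists unfolding chart_points_def by blast
  have coord: "Tay (coord_ratio a i j)" if "i < length ns" "j \<le> ns ! i" "j \<noteq> a i" for i j
    using Tay_basis[of "Some (i, j)"] that by (auto simp: jet_index_def jet_basis_def)
  have coord_mult: "Tay (coord_ratio a i j * u)"
    if ij: "i < length ns" "j \<le> ns ! i" "j \<noteq> a i" and Tu: "Tay u" for i j u
  proof -
    obtain c where c: "u - jet ns a c \<in> J" using Tu Tay_def by blast
    have z: "coord_ratio a i j \<in> structure_sheaf ns {a}"
      using a ij by (intro coord_ratio_structure_sheaf) auto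
    have basis: "Tay (coord_ratio a i j * jet_basis a t)" if ts: "t \<in> jet_index ns a" for t
    proof (cases t)
      case None
      then show ?thesis using coord[OF ij] by (simp add: jet_basis_def)
    next
      case (Some ij')
      then obtain i' j' where t: "t = Some (i', j')" "i' < length ns" "j' \<le> ns ! i'" "j' \<noteq> a i'"
        using ts unfolding jet_index_def by auto
      define b where "b = v i j / v i (a i)"
      define b' where "b' = v i' j' / v i' (a i')"
      have "(coord_ratio a i j - const_laurent b) * (coord_ratio a i' j' - const_laurent b') \<in> J"
        unfolding J_def b_def b'_def using a ij t p v
        by (intro double_point_ideal_intro coord_ratio_point_ideal) auto
      then have "Tay ((coord_ratio a i j - const_laurent b) * (coord_ratio a i' j' - const_laurent b')
          + (const_laurent b * coord_ratio a i' j' + (const_laurent b' * coord_ratio a i j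
          + const_laurent (- (b * b')) * 1)))"
        using ij t by (intro Tay_add Tay_scale coord one Tay_J) auto
      moreover have "const_laurent (- (b * b')) = - (const_laurent b * const_laurent b')"
        using const_laurent_hom(2)[of 0 "b * b'"] by (simp add: const_laurent_hom)
      ultimately show ?thesis
        by (simp add: t(1) jet_basis_def algebra_simps)
    qed
    have "coord_ratio a i j * (u - jet ns a c) \<in> J"
      unfolding J_def using z c[unfolded J_def] by (rule double_point_ideal_mult)
    moreover have "Tay (\<Sum>t\<in>jet_index ns a. const_laurent (c t) * (coord_ratio a i j * jet_basis a t))"
    proof -
      have "Tay (\<Sum>t\<in>X. const_laurent (c t) * (coord_ratio a i j * jet_basis a t))"
        if "finite X" "X \<subseteq> jet_index ns a" for X
        using that
      proof (induction X)
        case (insert t X)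
        then show ?case by (simp add: Tay_add Tay_scale basis)
      qed (use zero in auto)
      then show ?thesis using finite_jet_index by blast
    qed
    ultimately have "Tay (coord_ratio a i j * (u - jet ns a c) +
        (\<Sum>t\<in>jet_index ns a. const_laurent (c t) * (coord_ratio a i j * jet_basis a t)))"
      by (rule Tay_add[OF Tay_J])
    moreover have "(\<Sum>t\<in>jet_index ns a. const_laurent (c t) * (coord_ratio a i j * jet_basis a t)) =
        coord_ratio a i j * jet ns a c"
      by (simp add: jet_def sum_distrib_left mult_ac)
    ultimately show ?thesis by (simp add: algebra_simps)
  qed
  define K where "K = (SIGMA i:{..<length ns}. {..ns ! i} - {a i})"
  have finK: "finite K" unfolding K_def by auto
  \<comment> \<open>Induction on the total exponent over \<open>K\<close>, the variables not
    selected by the chart. Exponents there are nonnegative, since poles occur only along selected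
    variables.\<close>
  have monomial: "Tay (Poly_Mapping.single m 1)"
    if "admissible ns (\<lambda>_. 0) {a} m" "(\<Sum>k\<in>K. nat (Poly_Mapping.lookup m k)) = N" for m N
    using that
  proof (induction N arbitrary: m)
    case 0
    have supp: "i < length ns \<and> j \<le> ns ! i" if "Poly_Mapping.lookup m (i, j) \<noteq> 0" for i j
      using 0(1) that unfolding admissible_def by (auto simp: in_keys_iff)
    have zero: "Poly_Mapping.lookup m (i, j) = 0" if "j \<noteq> a i" for i j
    proof (rule ccontr)
      assume nz: "Poly_Mapping.lookup m (i, j) \<noteq> 0"
      then have "(i, j) \<in> K" using supp that unfolding K_def by auto
      then have "nat (Poly_Mapping.lookup m (i, j)) = 0" using 0(2) finK by simp
      then have "Poly_Mapping.lookup m (i, j) < 0" using nz by linarith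
      then show False using 0(1) that unfolding admissible_def by blast
    qed
    \<comment> \<open>With all other exponents zero, multidegree 0 forces the exponent of the
      selected variable to vanish as well.\<close>
    have "Poly_Mapping.lookup m (i, j) = 0" for i j
    proof (cases "i < length ns \<and> j = a i")
      case True
      have "(\<Sum>j\<le>ns ! i. Poly_Mapping.lookup m (i, j)) =
          (\<Sum>j\<in>{a i}. Poly_Mapping.lookup m (i, j))"
        using True chart_le[OF a] zero by (intro sum.mono_neutral_right) auto
      then show ?thesis using 0(1) True unfolding admissible_def by simp
    next
      case False
      then show ?thesis using supp zero by blast
    qed
    then have "m = 0" by (intro poly_mapping_eqI) (metis lookup_zero surj_pair)
    then show ?case using one by simp
  next
    case (Suc N)
    have "\<exists>k\<in>K. nat (Poly_Mapping.lookup m k) \<noteq> 0"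
      using Suc.prems(2) by (metis sum.neutral nat.distinct(1))
    then obtain i j where "(i, j) \<in> K" and pos: "Poly_Mapping.lookup m (i, j) > 0"
      by (metis nat_0_iff linorder_not_less surj_pair)
    then have ij: "i < length ns" "j \<le> ns ! i" "j \<noteq> a i" "Poly_Mapping.lookup m (i, j) > 0"
      unfolding K_def by auto
    \<comment> \<open>Splitting off one affine coordinate keeps multidegree 0 and changes the
      exponents over \<open>K\<close> only at \<open>(i, j)\<close>, because the compensating
      variable \<open>(i, a i)\<close> is not in \<open>K\<close>.\<close>
    define z :: "nat \<times> nat \<Rightarrow>\<^sub>0 int" where "z = Poly_Mapping.single (i, j) 1 - Poly_Mapping.single (i, a i) 1"
    define m' where "m' = m - z"
    have lkz: "Poly_Mapping.lookup z (i', j') =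
        (if i' = i then (if j' = j then 1 else 0) - (if j' = a i then 1 else 0) else 0)" for i' j'
      by (auto simp: z_def lookup_minus lookup_single when_def)
    have "admissible ns (\<lambda>_. 0) {a} m'"
      unfolding admissible_def
    proof (intro conjI allI impI)
      have "Poly_Mapping.keys m' \<subseteq> Poly_Mapping.keys m \<union> {(i, j), (i, a i)}"
        by (auto simp: m'_def in_keys_iff lookup_minus lkz split: if_splits)
      then show "\<forall>(i, j)\<in>Poly_Mapping.keys m'. i < length ns \<and> j \<le> ns ! i"
        using Suc.prems(1) ij chart_le[OF a] unfolding admissible_def by blast
      show "\<exists>a\<in>{a}. j' = a i'" if "Poly_Mapping.lookup m' (i', j') < 0" for i' j'
      proof (rule ccontr)
        assume *: "\<not> ?thesis"
        then have "Poly_Mapping.lookup m (i', j') < 0"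
          using that ij by (auto simp: m'_def lookup_minus lkz split: if_splits)
        then show False using Suc.prems(1) * unfolding admissible_def by blast
      qed
      show "(\<Sum>j'\<le>ns ! i'. Poly_Mapping.lookup m' (i', j')) = 0" if "i' < length ns" for i'
      proof (cases "i' = i")
        case True
        then show ?thesis
          using Suc.prems(1) ij(2) chart_le[OF a that] that unfolding admissible_def
          by (simp add: m'_def lookup_minus lkz sum_subtractf)
      next
        case False
        then show ?thesis
          using Suc.prems(1) that unfolding admissible_def by (simp add: m'_def lookup_minus lkz)
      qed
    qed
    moreover have "(\<Sum>k\<in>K. nat (Poly_Mapping.lookup m' k)) = N"
    proof -
      have ijK: "(i, j) \<in> K" using ij unfolding K_def by auto
      have "(\<Sum>k\<in>K - {(i, j)}. nat (Poly_Mapping.lookup m' k)) =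
          (\<Sum>k\<in>K - {(i, j)}. nat (Poly_Mapping.lookup m k))"
      proof (rule sum.cong[OF refl])
        fix k assume k: "k \<in> K - {(i, j)}"
        obtain i' j' where k': "k = (i', j')" by (cases k)
        have "Poly_Mapping.lookup z k = 0"
          using k unfolding k' lkz K_def by auto
        then show "nat (Poly_Mapping.lookup m' k) = nat (Poly_Mapping.lookup m k)"
          by (simp add: m'_def lookup_minus)
      qed
      moreover have "nat (Poly_Mapping.lookup m (i, j)) = Suc (nat (Poly_Mapping.lookup m' (i, j)))"
        using ij by (simp add: m'_def lookup_minus lkz)
      ultimately show ?thesis
        using Suc.prems(2) by (simp add: sum.remove[OF finK ijK])
    qed
    ultimately have "Tay (Poly_Mapping.single m' 1)" by (rule Suc.IH)
    then have "Tay (coord_ratio a i j * Poly_Mapping.single m' 1)"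
      using ij by (intro coord_mult)
    then show ?case
      by (simp add: coord_ratio_def mult_single m'_def flip: z_def)
  qed
  have "Tay (\<Sum>m\<in>Poly_Mapping.keys u. const_laurent (Poly_Mapping.lookup u m) * Poly_Mapping.single m 1)"
    using u unfolding structure_sheaf_def line_bundle_iff
    by (intro Tay_sum Tay_scale monomial[OF _ refl]) blast
  moreover have "(\<Sum>m\<in>Poly_Mapping.keys u. const_laurent (Poly_Mapping.lookup u m) * Poly_Mapping.single m 1) = u"
    by (subst (3) laurent_expansion[of u]) (simp add: const_laurent_def mult_single)
  ultimately show ?thesis using that unfolding Tay_def J_def by auto
qed

text \<open>A direction that fixes the selected coordinates leaves all denominators constant, so
  affine coordinates restrict to polynomials of degree at most one. The constant term
  \<open>b\<close> also involves the values of the coordinates at the point; it is identified only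
  when the linear coefficients vanish.\<close>

lemma restrict_to_line_jet:
  assumes a: "\<And>i. i < length ns \<Longrightarrow> v i (a i) \<noteq> 0 \<and> w i (a i) = 0"
  shows "\<exists>b. restrict_to_line (coords v) (coords w) (jet ns a c) = fls_const b +
    fls_const (\<Sum>(i, j)\<in>(SIGMA i:{..<length ns}. {..ns ! i} - {a i}). c (Some (i, j)) * (w i j / v i (a i)))
      * fls_X \<and> ((\<forall>t\<in>jet_index ns a. t \<noteq> None \<longrightarrow> c t = 0) \<longrightarrow> b = c None)"
proof -
  let ?K = "SIGMA i:{..<length ns}. {..ns ! i} - {a i}"
  let ?E = "restrict_to_line (coords v) (coords w)"
  define b where "b = c None + (\<Sum>(i, j)\<in>?K. c (Some (i, j)) * (v i j / v i (a i)))"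
  have const: "?E (const_laurent d * f) = fls_const d * ?E f" if "defined_at (coords v) f" for d f
    using that
    by (subst restrict_to_line_mult)
      (auto simp: const_laurent_def defined_at_single restrict_to_line_def
        laurent_value_single[OF field_hom_fls_const])
  have one: "?E 1 = 1"
    using laurent_value_single[OF field_hom_fls_const, of "line_germ (coords v) (coords w)" 0 1]
    by (simp add: restrict_to_line_def)
  have ratio: "?E (const_laurent (c (Some (i, j))) * coord_ratio a i j) =
      fls_const (c (Some (i, j)) * (v i j / v i (a i)))
      + fls_const (c (Some (i, j)) * (w i j / v i (a i))) * fls_X" if "i < length ns" for i j
  proof -
    have "defined_at (coords v) (coord_ratio a i j :: 'a laurent)"
      using a[OF that] unfolding coord_ratio_def
      by (intro defined_at_single)
        (auto simp: monomial_defined_at_def lookup_minus lookup_single when_def split: if_splits)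
    moreover have "?E (coord_ratio a i j) = fls_const (v i j / v i (a i)) + fls_const (w i j / v i (a i)) * fls_X"
    proof -
      have 1: "line_germ (coords v) (coords w) (i, a i) = fls_const (v i (a i))"
        using a[OF that] by (simp add: line_germ_def)
      have 2: "line_germ (coords v) (coords w) (i, j) = fls_const (v i j) + fls_const (w i j) * fls_X"
        by (simp add: line_germ_def)
      have "?E (coord_ratio a i j) = line_germ (coords v) (coords w) (i, j) / line_germ (coords v) (coords w) (i, a i)"
        using a[OF that] 1
        by (simp add: restrict_to_line_def coord_ratio_def laurent_value_single[OF field_hom_fls_const]
            monomial_value_ratio)
      also have "\<dots> = (fls_const (v i j) + fls_const (w i j) * fls_X) * fls_const (inverse (v i (a i)))"
        unfolding 1 2 by (simp add: divide_inverse fls_inverse_const)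
      also have "\<dots> = fls_const (v i j / v i (a i)) + fls_const (w i j / v i (a i)) * fls_X"
        by (simp add: distrib_left divide_inverse mult_ac del: fls_const_mult_const flip: fls_const_mult_const)
      finally show ?thesis .
    qed
    ultimately show ?thesis
      by (simp add: const distrib_left fls_const_mult_const mult.assoc)
  qed
  have "jet ns a c = const_laurent (c None) * 1 + (\<Sum>(i, j)\<in>?K. const_laurent (c (Some (i, j))) * coord_ratio a i j)"
    unfolding jet_def jet_index_def
    by (subst sum.insert) (auto simp: jet_basis_def sum.reindex case_prod_unfold)
  then have "?E (jet ns a c) = ?E (const_laurent (c None) * 1) +
      (\<Sum>(i, j)\<in>?K. ?E (const_laurent (c (Some (i, j))) * coord_ratio a i j))"
    by (simp only: restrict_to_line_add restrict_to_line_sum case_prod_unfold)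
  also have "?E (const_laurent (c None) * 1) = fls_const (c None)"
    using const[of 1 "c None"] one defined_at_single[of "coords v" 0 "1 :: 'a"] by simp
  also have "(\<Sum>(i, j)\<in>?K. ?E (const_laurent (c (Some (i, j))) * coord_ratio a i j)) =
      (\<Sum>(i, j)\<in>?K. fls_const (c (Some (i, j)) * (v i j / v i (a i)))
      + fls_const (c (Some (i, j)) * (w i j / v i (a i))) * fls_X)"
    by (intro sum.cong refl) (auto simp: ratio)
  also have "fls_const (c None) + \<dots> = fls_const b + fls_const (\<Sum>(i, j)\<in>?K. c (Some (i, j)) * (w i j / v i (a i))) * fls_X"
  proof -
    have fsum: "fls_const (\<Sum>k\<in>T. h k) = (\<Sum>k\<in>T. fls_const (h k))" for T :: "(nat \<times> nat) set" and h :: "_ \<Rightarrow> 'a"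
      by (induction T rule: infinite_finite_induct) (simp_all flip: fls_plus_const)
    show ?thesis
      by (simp add: b_def case_prod_unfold sum.distrib fsum sum_distrib_right add.assoc flip: fls_plus_const)
  qed
  finally have "?E (jet ns a c) = fls_const b +
      fls_const (\<Sum>(i, j)\<in>?K. c (Some (i, j)) * (w i j / v i (a i))) * fls_X" .
  moreover have "b = c None" if "\<forall>t\<in>jet_index ns a. t \<noteq> None \<longrightarrow> c t = 0"
  proof -
    have "c (Some (i, j)) = 0" if "(i, j) \<in> ?K" for i j
    proof -
      have "Some (i, j) \<in> jet_index ns a" using that unfolding jet_index_def by blast
      then show ?thesis using \<open>\<forall>t\<in>jet_index ns a. t \<noteq> None \<longrightarrow> c t = 0\<close> by blast
    qed
    then have "(\<Sum>(i, j)\<in>?K. c (Some (i, j)) * (v i j / v i (a i))) = 0"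
      by (intro sum.neutral) auto
    then show ?thesis by (simp add: b_def)
  qed
  ultimately show ?thesis by blast
qed

text \<open>Lines in the coordinate directions read off the coefficients one by one. Together with
  \<open>taylor_expansion\<close> this makes functions modulo the square of the ideal a space of
  dimension n+1; allowing any \<open>A\<close> with \<open>p\<close> in its open set lets the
  coefficients be read after shrinking the chart.\<close>

lemma jet_eq_zero:
  assumes a: "a \<in> A" and p: "p \<in> chart_points ns A"
    and jet: "jet ns a c \<in> double_point_ideal_sheaf ns p A" and t: "t \<in> jet_index ns a"
  shows "c t = 0"
proof -
  have pm: "p \<in> multiproj_space ns" using p by (simp add: chart_points_def)
  obtain v where v: "representative ns p v" using pm by (rule representative_exists)
  have nz: "v i (a i) \<noteq> 0" if "i < length ns" for i
    using chart_points_iff[OF pm v] p a that by blast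
  have zero: "vanishes_doubly (restrict_to_line (coords v) w (jet ns a c))" for w
    using double_point_ideal_vanishes_doubly[OF p v jet] .
  have Some: "c (Some (i, j)) = 0" if ij: "i < length ns" "j \<le> ns ! i" "j \<noteq> a i" for i j
  proof -
    \<comment> \<open>Moving only the coordinate \<open>(i, j)\<close> isolates its coefficient,
      divided by \<open>v i (a i)\<close>.\<close>
    define w where "w i' j' = (if i' = i \<and> j' = j then 1 else 0 :: 'a)" for i' j'
    have w: "v i (a i) \<noteq> 0 \<and> w i (a i) = 0" if "i < length ns" for i
      using nz that ij by (auto simp: w_def)
    let ?K = "SIGMA i:{..<length ns}. {..ns ! i} - {a i}"
    obtain b where b: "restrict_to_line (coords v) (coords w) (jet ns a c) = fls_const b +
        fls_const (\<Sum>(i, j)\<in>?K. c (Some (i, j)) * (w i j / v i (a i))) * fls_X"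
      using restrict_to_line_jet[of ns v a w c, OF w] by blast
    have "(\<Sum>(i, j)\<in>?K. c (Some (i, j)) * (w i j / v i (a i))) = 0"
      using zero[of "coords w"] unfolding b by (rule vanishes_doubly_line)
    moreover have "(\<Sum>(i, j)\<in>?K. c (Some (i, j)) * (w i j / v i (a i))) =
        (\<Sum>k\<in>?K. if k = (i, j) then c (Some (i, j)) / v i (a i) else 0)"
    proof (rule sum.cong[OF refl])
      fix k :: "nat \<times> nat"
      obtain i' j' where k: "k = (i', j')" by (cases k)
      show "(case k of (i, j) \<Rightarrow> c (Some (i, j)) * (w i j / v i (a i))) =
          (if k = (i, j) then c (Some (i, j)) / v i (a i) else 0)"
        unfolding k w_def by (cases "i' = i \<and> j' = j") auto
    qed
    ultimately have "c (Some (i, j)) / v i (a i) = 0"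
      using ij by simp
    then show ?thesis using nz ij by simp
  qed
  then have all: "\<forall>t\<in>jet_index ns a. t \<noteq> None \<longrightarrow> c t = 0"
    unfolding jet_index_def by auto
  \<comment> \<open>The linear coefficients are gone, so the constant one is visible along the zero
    direction.\<close>
  define w :: "nat \<Rightarrow> nat \<Rightarrow> 'a" where "w = (\<lambda>_ _. 0)"
  have w: "v i (a i) \<noteq> 0 \<and> w i (a i) = 0" if "i < length ns" for i
    using nz that by (simp add: w_def)
  obtain b where b: "restrict_to_line (coords v) (coords w) (jet ns a c) = fls_const b +
      fls_const (\<Sum>(i, j)\<in>(SIGMA i:{..<length ns}. {..ns ! i} - {a i}). c (Some (i, j)) * (w i j / v i (a i))) * fls_X"
    and "b = c None"
    using restrict_to_line_jet[of ns v a w c, OF w] all by blast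
  have "b = 0"
    using zero[of "coords w"] unfolding b by (rule vanishes_doubly_line)
  then have "c None = 0" using \<open>b = c None\<close> by simp
  then show ?thesis using all t by metis
qed

text \<open>Membership depends only on a neighbourhood of the point. The jet of the Taylor expansion
  over \<open>{a}\<close> lies in the ideal over \<open>A\<close>, hence is zero, and
  \<open>u\<close> equals its remainder. This carries conditions on overlaps back to single
  charts.\<close>

lemma double_point_ideal_local:
  assumes "a \<in> charts ns" "a \<in> A" "p \<in> chart_points ns A"
    and u: "u \<in> structure_sheaf ns {a}" "u \<in> double_point_ideal_sheaf ns p A"
  shows "u \<in> double_point_ideal_sheaf ns p {a}"
proof -
  have "p \<in> chart_points ns {a}"
    using assms(2,3) unfolding chart_points_def by blast
  then obtain c where c: "u - jet ns a c \<in> double_point_ideal_sheaf ns p {a}"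
    using taylor_expansion[OF assms(1) _ u(1)] by blast
  then have "u - jet ns a c \<in> double_point_ideal_sheaf ns p A"
    using double_point_ideal_mono[of "{a}" A] assms(2) by blast
  then have "u - (u - jet ns a c) \<in> double_point_ideal_sheaf ns p A"
    using u(2) by (rule double_point_ideal_diff[rotated])
  then have "c t = 0" if "t \<in> jet_index ns a" for t
    using jet_eq_zero[OF assms(2,3) _ that] by simp
  then have "jet ns a c = 0"
    unfolding jet_def by (simp add: const_laurent_hom)
  then show ?thesis using c by simp
qed

text \<open>The two trivialisations differ by the quotient of the chart monomials, which is regular
  once the denominator's chart \<open>b\<close> belongs to \<open>A\<close>.\<close>

lemma double_point_ideal_change_chart:
  assumes "a \<in> charts ns" "b \<in> charts ns" "b \<in> A"
    and "chart_section_inv ns a * f \<in> double_point_ideal_sheaf ns p A"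
  shows "chart_section_inv ns b * f \<in> double_point_ideal_sheaf ns p A"
proof -
  have "(chart_section_inv ns b * chart_section ns a) * (chart_section_inv ns a * f)
      \<in> double_point_ideal_sheaf ns p A"
    using chart_section_inv_mult[OF assms(2,3) chart_section_line_bundle[OF assms(1)]] assms(4)
    by (rule double_point_ideal_mult)
  moreover have "(chart_section_inv ns b * chart_section ns a) * (chart_section_inv ns a * f) =
      chart_section_inv ns b * (chart_section ns a * chart_section_inv ns a) * f"
    by (simp only: mult_ac)
  ultimately show ?thesis by simp
qed

text \<open>Over an open set inside the chart \<open>a\<close> the line bundle is free on
  \<open>chart_section\<close>, so tensoring amounts to dividing by this generator. Conversely,
  \<open>f\<close> is its quotient by the generator times the generator.\<close>

lemma twist_iff:
  assumes a: "a \<in> charts ns" "a \<in> A"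
  shows "f \<in> twist ns (\<lambda>_. 1) (double_points_ideal_sheaf ns S) A \<longleftrightarrow>
    f \<in> line_bundle ns (\<lambda>_. 1) A \<and>
    (\<forall>p\<in>S. chart_section_inv ns a * f \<in> double_point_ideal_sheaf ns p A)"
proof
  assume "f \<in> twist ns (\<lambda>_. 1) (double_points_ideal_sheaf ns S) A"
  then show "f \<in> line_bundle ns (\<lambda>_. 1) A \<and>
    (\<forall>p\<in>S. chart_section_inv ns a * f \<in> double_point_ideal_sheaf ns p A)"
    unfolding twist_def
  proof (induction rule: module_product_induct)
    case (mult x y)
    then have x: "x \<in> structure_sheaf ns A" "\<And>p. p \<in> S \<Longrightarrow> x \<in> double_point_ideal_sheaf ns p A"
      by (auto simp: double_points_ideal_sheaf_def)
    have "(chart_section_inv ns a * y) * x \<in> double_point_ideal_sheaf ns p A" if "p \<in> S" for p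
      using x(2)[OF that] mult a by (intro double_point_ideal_mult chart_section_inv_mult)
    moreover have "x * y \<in> line_bundle ns (\<lambda>_. 1) A"
      using x mult by (intro structure_sheaf_line_bundle_mult)
    ultimately show ?case by (simp add: mult_ac)
  qed (auto simp: double_point_ideal_zero distrib_left line_bundle_add double_point_ideal_add)
next
  assume f: "f \<in> line_bundle ns (\<lambda>_. 1) A \<and>
    (\<forall>p\<in>S. chart_section_inv ns a * f \<in> double_point_ideal_sheaf ns p A)"
  then have "(chart_section_inv ns a * f) * chart_section ns a
      \<in> twist ns (\<lambda>_. 1) (double_points_ideal_sheaf ns S) A"
    unfolding twist_def using a
    by (intro module_product_mult chart_section_line_bundle)
      (auto simp: double_points_ideal_sheaf_def intro: chart_section_inv_mult)
  moreover have "(chart_section_inv ns a * f) * chart_section ns a =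
      (chart_section_inv ns a * chart_section ns a) * f"
    by (simp only: mult_ac)
  ultimately show "f \<in> twist ns (\<lambda>_. 1) (double_points_ideal_sheaf ns S) A" by simp
qed

section \<open>Linear algebra\<close>

text \<open>Gaussian elimination, one equation at a time; \<open>X\<close> indexes the unknowns and
  \<open>Y\<close> the equations.\<close>

lemma homogeneous_system_nontrivial:
  fixes M :: "'x \<Rightarrow> 'y \<Rightarrow> 'k::field"
  assumes "finite Y" "finite X" "card Y < card X"
  shows "\<exists>c. (\<exists>x\<in>X. c x \<noteq> 0) \<and> (\<forall>y\<in>Y. (\<Sum>x\<in>X. c x * M x y) = 0)"
  using assms
proof (induction Y arbitrary: X M rule: finite_induct)
  case empty
  then have "X \<noteq> {}" by auto
  then show ?case by (intro exI[of _ "\<lambda>_. 1"]) auto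
next
  case (insert y Y)
  show ?case
  proof (cases "\<forall>x\<in>X. M x y = 0")
    case True
    have "card Y < card X" using insert by simp
    then obtain c where "\<exists>x\<in>X. c x \<noteq> 0" "\<forall>z\<in>Y. (\<Sum>x\<in>X. c x * M x z) = 0"
      using insert.IH[OF insert.prems(1)] by blast
    then show ?thesis using True by (intro exI[of _ c]) auto
  next
    case False
    then obtain x0 where x0: "x0 \<in> X" "M x0 y \<noteq> 0" by blast
    \<comment> \<open>The system after the pivot \<open>x0\<close> has been eliminated by means of
      equation \<open>y\<close>.\<close>
    define M' where "M' x z = M x z - M x y / M x0 y * M x0 z" for x z
    have "card Y < card (X - {x0})" using insert x0 by simp
    then obtain c where c: "\<exists>x\<in>X - {x0}. c x \<noteq> 0" "\<forall>z\<in>Y. (\<Sum>x\<in>X - {x0}. c x * M' x z) = 0"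
      using insert.IH[of "X - {x0}" M'] insert.prems by blast
    \<comment> \<open>Back substitution: the value at the pivot is the one that solves equation
      \<open>y\<close>.\<close>
    define c' where "c' = c(x0 := - (\<Sum>x\<in>X - {x0}. c x * (M x y / M x0 y)))"
    have c': "(\<Sum>x\<in>X. c' x * M x z) = (\<Sum>x\<in>X - {x0}. c x * M' x z)" for z
    proof -
      have "(\<Sum>x\<in>X. c' x * M x z) = c' x0 * M x0 z + (\<Sum>x\<in>X - {x0}. c' x * M x z)"
        using sum.remove[OF insert.prems(1) x0(1)] .
      also have "(\<Sum>x\<in>X - {x0}. c' x * M x z) = (\<Sum>x\<in>X - {x0}. c x * M x z)"
        by (intro sum.cong) (auto simp: c'_def)
      finally show ?thesis
        by (simp add: c'_def M'_def algebra_simps sum_subtractf sum_distrib_left)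
    qed
    have "(\<Sum>x\<in>X. c' x * M x z) = 0" if "z \<in> insert y Y" for z
    proof (cases "z = y")
      case True
      have "M' x y = 0" for x using x0 by (simp add: M'_def)
      then show ?thesis unfolding c' True by simp
    qed (use that c' c in auto)
    moreover have "\<exists>x\<in>X. c' x \<noteq> 0"
      using c(1) by (auto simp: c'_def)
    ultimately show ?thesis by blast
  qed
qed

section \<open>Bounding the dimension of a quotient by independent families\<close>

lemma quotient_dim_le:
  assumes "\<And>B. finite B \<Longrightarrow> B \<subseteq> V \<Longrightarrow>
      (\<And>c. (\<Sum>b\<in>B. scale (c b) b) \<in> W \<Longrightarrow> \<forall>b\<in>B. c b = 0) \<Longrightarrow> card B \<le> N"
  shows "quotient_dim scale V W \<le> enat N"
  unfolding quotient_dim_def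
proof (rule Sup_least)
  fix x assume "x \<in> {enat (card B) | B. finite B \<and> B \<subseteq> V \<and>
     (\<forall>c. (\<Sum>b\<in>B. scale (c b) b) \<in> W \<longrightarrow> (\<forall>b\<in>B. c b = 0))}"
  then obtain B where B: "x = enat (card B)" "finite B" "B \<subseteq> V"
    "\<And>c. (\<Sum>b\<in>B. scale (c b) b) \<in> W \<Longrightarrow> \<forall>b\<in>B. c b = 0"
    by blast
  show "x \<le> enat N"
    unfolding B(1) enat_ord_simps using B(2-4) by (rule assms)
qed

text \<open>\<open>quotient_dim\<close> counts sets while the cocycles arise as a family. A repeated
  member would give the relation with coefficients 1 and -1, whose sum 0 lies in \<open>W\<close>,
  so an independent family is injective.\<close>

lemma quotient_dim_ge:
  fixes scale :: "'k::ring_1 \<Rightarrow> 'v \<Rightarrow> 'v::comm_monoid_add"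
  assumes "finite X" "\<And>x. x \<in> X \<Longrightarrow> g x \<in> V" "0 \<in> W"
    and scale: "\<And>v. scale 0 v = 0" "\<And>v. scale 1 v + scale (- 1) v = 0"
    and indep: "\<And>c. (\<Sum>x\<in>X. scale (c x) (g x)) \<in> W \<Longrightarrow> \<forall>x\<in>X. c x = 0"
  shows "enat (card X) \<le> quotient_dim scale V W"
proof -
  have inj: "inj_on g X"
  proof (rule inj_onI, rule ccontr)
    fix x y assume xy: "x \<in> X" "y \<in> X" "g x = g y" "x \<noteq> y"
    define c :: "_ \<Rightarrow> 'k" where "c z = (if z = x then 1 else if z = y then - 1 else 0)" for z
    have "(\<Sum>z\<in>X. scale (c z) (g z)) = (\<Sum>z\<in>{x, y}. scale (c z) (g z))"
      using xy assms(1) by (intro sum.mono_neutral_right) (auto simp: c_def scale)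
    also have "\<dots> = 0"
      using xy by (simp add: c_def scale)
    finally have "c x = 0"
      using indep[of c] assms(3) xy(1) by simp
    then show False by (simp add: c_def)
  qed
  have "\<forall>b\<in>g ` X. c b = 0" if "(\<Sum>b\<in>g ` X. scale (c b) b) \<in> W" for c
  proof -
    have "(\<Sum>x\<in>X. scale (c (g x)) (g x)) \<in> W"
      using that by (simp add: sum.reindex[OF inj])
    then show ?thesis using indep[of "\<lambda>x. c (g x)"] by blast
  qed
  then have "enat (card (g ` X)) \<le> quotient_dim scale V W"
    unfolding quotient_dim_def using assms(1,2) by (intro Sup_upper) blast
  then show ?thesis by (simp add: card_image[OF inj])
qed

section \<open>The upper bound\<close>

text \<open>
  The first cohomology of \<open>\<O>(1, \<dots>, 1)\<close> vanishes monomial by monomial: a monomial of positive degree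
  in every factor admits a chart \<open>e\<close> avoiding all its poles, and contraction of a cocycle with \<open>e\<close>
  gives a cochain bounding it.
\<close>

lemma line_bundle_cocycle_exact:
  fixes g :: "(nat \<Rightarrow> nat) \<Rightarrow> (nat \<Rightarrow> nat) \<Rightarrow> 'k::field laurent"
  assumes g: "\<And>a b. a \<in> charts ns \<Longrightarrow> b \<in> charts ns \<Longrightarrow> g a b \<in> line_bundle ns (\<lambda>_. 1) {a, b}"
    and cocycle: "\<And>a b c. a \<in> charts ns \<Longrightarrow> b \<in> charts ns \<Longrightarrow> c \<in> charts ns \<Longrightarrow> g b c - g a c + g a b = 0"
  shows "\<exists>f. (\<forall>a\<in>charts ns. f a \<in> line_bundle ns (\<lambda>_. 1) {a}) \<and>
    (\<forall>a\<in>charts ns. \<forall>b\<in>charts ns. g a b = f b - f a)"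
proof -
  define good where "good m e \<longleftrightarrow> e \<in> charts ns \<and> (\<forall>i<length ns. Poly_Mapping.lookup m (i, e i) \<ge> 0)"
    for m :: "nat \<times> nat \<Rightarrow>\<^sub>0 int" and e
  define a0 where "a0 = restrict (\<lambda>_. 0::nat) {..<length ns}"
  have a0: "a0 \<in> charts ns" unfolding a0_def charts_def by auto
  \<comment> \<open>The chart depends on the monomial alone, as the cochain requires. The default
    \<open>a0\<close> only keeps \<open>e m\<close> inside \<open>charts ns\<close>; monomials that
    actually occur in the cochain turn out to have a good chart.\<close>
  define e where "e m = (if \<exists>e. good m e then SOME e. good m e else a0)" for m
  have good_e: "good m (e m)" if "good m e'" for m e'
    using someI[of "good m" e'] that unfolding e_def by auto
  have e: "e m \<in> charts ns" for m
  proof (cases "\<exists>e'. good m e'")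
    case True
    then show ?thesis using good_e good_def by blast
  qed (simp add: e_def a0)
  have fin: "finite (charts ns)" unfolding charts_def by (intro finite_PiE) auto
  define K where "K b = (\<Union>a\<in>charts ns. Poly_Mapping.keys (g a b))" for b
  \<comment> \<open>Coefficient by coefficient, the contraction of \<open>g\<close> in its first
    argument with the chart \<open>e m\<close>.\<close>
  define f where "f b = (\<Sum>m\<in>K b. Poly_Mapping.single m (Poly_Mapping.lookup (g (e m) b) m))" for b
  have lk: "Poly_Mapping.lookup (f b) m = Poly_Mapping.lookup (g (e m) b) m" for b m
  proof -
    have "finite (K b)" unfolding K_def using fin by auto
    then have "Poly_Mapping.lookup (f b) m = (if m \<in> K b then Poly_Mapping.lookup (g (e m) b) m else 0)"
      unfolding f_def lookup_sum lookup_single when_def by simp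
    moreover have "m \<in> K b" if "Poly_Mapping.lookup (g (e m) b) m \<noteq> 0"
      using that e unfolding K_def by (auto simp: in_keys_iff)
    ultimately show ?thesis by auto
  qed
  have "g a b = f b - f a" if "a \<in> charts ns" "b \<in> charts ns" for a b
  proof (rule poly_mapping_eqI)
    fix m
    have "g a b = g (e m) b - g (e m) a"
      using cocycle[OF e that, of m] by (simp add: algebra_simps add_eq_0_iff)
    then show "Poly_Mapping.lookup (g a b) m = Poly_Mapping.lookup (f b - f a) m"
      by (simp add: lookup_minus lk)
  qed
  moreover have "f b \<in> line_bundle ns (\<lambda>_. 1) {b}" if b: "b \<in> charts ns" for b
    unfolding line_bundle_iff
  proof
    fix m assume "m \<in> Poly_Mapping.keys (f b)"
    then have adm: "admissible ns (\<lambda>_. 1) {e m, b} m"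
      using g[OF e[of m] b] unfolding line_bundle_iff by (auto simp: in_keys_iff lk)
    \<comment> \<open>The degree 1 in each factor enters here: a sum of negative exponents could not
      equal 1.\<close>
    have "\<exists>j\<le>ns ! i. Poly_Mapping.lookup m (i, j) \<ge> 0" if "i < length ns" for i
    proof (rule ccontr)
      assume "\<not> ?thesis"
      then have "(\<Sum>j\<le>ns ! i. Poly_Mapping.lookup m (i, j)) \<le> 0"
        by (intro sum_nonpos) force
      then show False using adm that unfolding admissible_def by auto
    qed
    then obtain e' where e': "\<And>i. i < length ns \<Longrightarrow> e' i \<le> ns ! i \<and> Poly_Mapping.lookup m (i, e' i) \<ge> 0"
      by metis
    have "good m (restrict e' {..<length ns})"
      using e' unfolding good_def charts_def by auto
    then have good: "good m (e m)" by (rule good_e)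
    have "j = b i" if neg: "Poly_Mapping.lookup m (i, j) < 0" for i j
    proof -
      have "(i, j) \<in> Poly_Mapping.keys m" using neg by (simp add: in_keys_iff)
      then have "i < length ns" using adm unfolding admissible_def by blast
      then have "j \<noteq> e m i" using good neg unfolding good_def by force
      then show ?thesis using adm neg unfolding admissible_def by blast
    qed
    then show "admissible ns (\<lambda>_. 1) {b} m"
      using adm unfolding admissible_def by blast
  qed
  ultimately show ?thesis by blast
qed

lemma sum_fun2_apply: "(\<Sum>x\<in>X. h x) a b = (\<Sum>x\<in>X. h x a b :: 'm::comm_monoid_add)"
  by (induction X rule: infinite_finite_induct) auto

lemma twist_subset_line_bundle:
  "a \<in> charts ns \<Longrightarrow> a \<in> A \<Longrightarrow>
    twist ns (\<lambda>_. 1) (double_points_ideal_sheaf ns S) A \<subseteq> line_bundle ns (\<lambda>_. 1) A"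
  using twist_iff by blast

text \<open>
  A cochain is tested against the Taylor coefficients at the points of \<open>S\<close>: independent classes in
  \<open>H\<^sup>1\<close> together with global sections independent on \<open>2S\<close> cannot outnumber these coefficients.
\<close>

lemma h1_double_points_le:
  fixes S :: "(nat \<Rightarrow> (nat \<Rightarrow> 'k::field) set) set" and \<gamma> :: "'g \<Rightarrow> 'k laurent"
  assumes S: "S \<subseteq> multiproj_space ns" "finite S" and G: "finite G"
    and \<gamma>: "\<And>x. x \<in> G \<Longrightarrow> \<gamma> x \<in> line_bundle ns (\<lambda>_. 1) {}"
    and indep: "\<And>c. (\<And>p a. p \<in> S \<Longrightarrow> a \<in> charts ns \<Longrightarrow> p \<in> chart_points ns {a} \<Longrightarrow>
        chart_section_inv ns a * (\<Sum>x\<in>G. const_laurent (c x) * \<gamma> x) \<in> double_point_ideal_sheaf ns p {a})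
      \<Longrightarrow> \<forall>x\<in>G. c x = 0"
  shows "h1 ns (twist ns (\<lambda>_. 1) (double_points_ideal_sheaf ns S)) \<le>
    enat (card S * (sum_list ns + 1) - card G)"
  unfolding h1_def
proof (rule quotient_dim_le)
  let ?F = "twist ns (\<lambda>_. 1) (double_points_ideal_sheaf ns S)"
  let ?L = "line_bundle ns (\<lambda>_. 1)"
  fix B :: "((nat \<Rightarrow> nat) \<Rightarrow> (nat \<Rightarrow> nat) \<Rightarrow> 'k laurent) set"
  assume B: "finite B" "B \<subseteq> cech_cocycles1 (charts ns) ?F"
    and Bindep: "\<And>c. (\<Sum>b\<in>B. (\<lambda>a a'. const_laurent (c b) * b a a')) \<in>
      cech_coboundaries1 (charts ns) ?F \<Longrightarrow> \<forall>b\<in>B. c b = 0"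
  have BF: "b a a' \<in> ?F {a, a'}" if "b \<in> B" "a \<in> charts ns" "a' \<in> charts ns" for b a a'
    using B that unfolding cech_cocycles1_def by blast
  have BL: "b a a' \<in> ?L {a, a'}" if "b \<in> B" "a \<in> charts ns" "a' \<in> charts ns" for b a a'
    using BF[OF that] twist_subset_line_bundle[OF that(2), of "{a, a'}" S] by blast
  have "\<forall>b\<in>B. \<exists>f. (\<forall>a\<in>charts ns. f a \<in> ?L {a}) \<and>
      (\<forall>a\<in>charts ns. \<forall>a'\<in>charts ns. b a a' = f a' - f a)"
  proof
    fix b assume b: "b \<in> B"
    show "\<exists>f. (\<forall>a\<in>charts ns. f a \<in> ?L {a}) \<and>
      (\<forall>a\<in>charts ns. \<forall>a'\<in>charts ns. b a a' = f a' - f a)"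
      by (rule line_bundle_cocycle_exact) (use b B BL in \<open>auto simp: cech_cocycles1_def\<close>)
  qed
  then obtain f where f: "\<And>b a. b \<in> B \<Longrightarrow> a \<in> charts ns \<Longrightarrow> f b a \<in> ?L {a}"
    "\<And>b a a'. b \<in> B \<Longrightarrow> a \<in> charts ns \<Longrightarrow> a' \<in> charts ns \<Longrightarrow> b a a' = f b a' - f b a"
    by metis
  have "\<forall>p\<in>S. \<exists>a. a \<in> charts ns \<and> p \<in> chart_points ns {a}"
    using S chart_exists by blast
  then obtain \<alpha> where \<alpha>: "\<And>p. p \<in> S \<Longrightarrow> \<alpha> p \<in> charts ns" "\<And>p. p \<in> S \<Longrightarrow> p \<in> chart_points ns {\<alpha> p}"
    by metis
  have taylor: "\<exists>c. chart_section_inv ns (\<alpha> p) * h - jet ns (\<alpha> p) c \<in> double_point_ideal_sheaf ns p {\<alpha> p}"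
    if "p \<in> S" "h \<in> ?L {\<alpha> p}" for p h
    using taylor_expansion[OF \<alpha>[OF that(1)] chart_section_inv_mult[OF \<alpha>(1)[OF that(1)] _ that(2)]] by blast
  have \<gamma>L: "\<gamma> x \<in> ?L A" if "x \<in> G" for x A
    using \<gamma>[OF that] line_bundle_mono[of "{}" A ns] by blast
  have "\<forall>b\<in>B. \<forall>p\<in>S. \<exists>c. chart_section_inv ns (\<alpha> p) * f b (\<alpha> p) - jet ns (\<alpha> p) c \<in>
      double_point_ideal_sheaf ns p {\<alpha> p}"
    using taylor f(1) \<alpha>(1) by blast
  then obtain \<kappa> where \<kappa>: "\<And>b p. b \<in> B \<Longrightarrow> p \<in> S \<Longrightarrow>
      chart_section_inv ns (\<alpha> p) * f b (\<alpha> p) - jet ns (\<alpha> p) (\<kappa> b p) \<in> double_point_ideal_sheaf ns p {\<alpha> p}"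
    by metis
  have "\<forall>x\<in>G. \<forall>p\<in>S. \<exists>c. chart_section_inv ns (\<alpha> p) * \<gamma> x - jet ns (\<alpha> p) c \<in>
      double_point_ideal_sheaf ns p {\<alpha> p}"
    using taylor \<gamma>L by blast
  then obtain \<mu> where \<mu>: "\<And>x p. x \<in> G \<Longrightarrow> p \<in> S \<Longrightarrow>
      chart_section_inv ns (\<alpha> p) * \<gamma> x - jet ns (\<alpha> p) (\<mu> x p) \<in> double_point_ideal_sheaf ns p {\<alpha> p}"
    by metis
  define Y where "Y = (SIGMA p:S. jet_index ns (\<alpha> p))"
  have cardY: "card Y = card S * (sum_list ns + 1)"
  proof -
    have "card Y = (\<Sum>p\<in>S. card (jet_index ns (\<alpha> p)))"
      unfolding Y_def by (rule card_SigmaI) (use S finite_jet_index in auto)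
    then show ?thesis using \<alpha>(1) card_jet_index by simp
  qed
  show "card B \<le> card S * (sum_list ns + 1) - card G"
  proof (rule ccontr)
    assume "\<not> ?thesis"
    \<comment> \<open>The negated bound gives this also when the subtraction truncates to 0.\<close>
    then have less: "card Y < card (B <+> G)"
      using B(1) G by (simp add: cardY card_Plus)
    define M where "M x y = (case x of Inl b \<Rightarrow> \<kappa> b (fst y) (snd y) | Inr x \<Rightarrow> \<mu> x (fst y) (snd y))"
      for x and y :: "(nat \<Rightarrow> (nat \<Rightarrow> 'k) set) \<times> (nat \<times> nat) option"
    have "finite Y" unfolding Y_def using S finite_jet_index by auto
    then have "\<exists>c. (\<exists>x\<in>B <+> G. c x \<noteq> 0) \<and> (\<forall>y\<in>Y. (\<Sum>x\<in>B <+> G. c x * M x y) = 0)"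
      using finite_Plus[OF B(1) G] less by (rule homogeneous_system_nontrivial)
    then obtain c where c: "\<exists>x\<in>B <+> G. c x \<noteq> 0" "\<And>y. y \<in> Y \<Longrightarrow> (\<Sum>x\<in>B <+> G. c x * M x y) = 0"
      by (elim exE conjE) (rule that, assumption, erule bspec)
    have c': "(\<Sum>b\<in>B. c (Inl b) * \<kappa> b p t) + (\<Sum>x\<in>G. c (Inr x) * \<mu> x p t) = 0"
      if "p \<in> S" "t \<in> jet_index ns (\<alpha> p)" for p t
      using c(2)[of "(p, t)"] that B(1) G by (simp add: Y_def sum.Plus M_def)
    define s where "s = (\<Sum>x\<in>G. const_laurent (c (Inr x)) * \<gamma> x)"
    \<comment> \<open>One unknown for each class and one for each global section: \<open>F\<close>
      bounds the combination of the cocycles, since the global part \<open>s\<close> cancels in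
      differences.\<close>
    define F where "F a = (\<Sum>b\<in>B. const_laurent (c (Inl b)) * f b a) + s" for a
    have sL: "s \<in> ?L A" for A
      unfolding s_def by (intro line_bundle_sum const_laurent_line_bundle \<gamma>L)
    have FL: "F a \<in> ?L {a}" if "a \<in> charts ns" for a
      unfolding F_def using f that
      by (intro line_bundle_add line_bundle_sum const_laurent_line_bundle sL) auto
    have F_diff: "F a' - F a = (\<Sum>b\<in>B. const_laurent (c (Inl b)) * b a a')"
      if a: "a \<in> charts ns" "a' \<in> charts ns" for a a'
    proof -
      have "(\<Sum>b\<in>B. const_laurent (c (Inl b)) * b a a') =
          (\<Sum>b\<in>B. const_laurent (c (Inl b)) * (f b a' - f b a))"
        by (rule sum.cong[OF refl]) (simp add: f(2)[OF _ a])
      then show ?thesis by (simp add: F_def right_diff_distrib sum_subtractf)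
    qed
    \<comment> \<open>The linear system says exactly that the jet \<open>d\<close> of
      \<open>F\<close> at \<open>p\<close> is zero in the chosen chart.\<close>
    have F\<alpha>: "chart_section_inv ns (\<alpha> p) * F (\<alpha> p) \<in> double_point_ideal_sheaf ns p {\<alpha> p}" if p: "p \<in> S" for p
    proof -
      let ?J = "double_point_ideal_sheaf ns p {\<alpha> p}" and ?y = "chart_section_inv ns (\<alpha> p) :: 'k laurent"
      define d where "d t = (\<Sum>b\<in>B. c (Inl b) * \<kappa> b p t) + (\<Sum>x\<in>G. c (Inr x) * \<mu> x p t)" for t
      have "jet ns (\<alpha> p) d = 0"
        unfolding jet_def using c'[OF p] by (simp add: d_def const_laurent_hom)
      moreover have "jet ns (\<alpha> p) d = (\<Sum>b\<in>B. const_laurent (c (Inl b)) * jet ns (\<alpha> p) (\<kappa> b p)) +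
          (\<Sum>x\<in>G. const_laurent (c (Inr x)) * jet ns (\<alpha> p) (\<mu> x p))"
        unfolding d_def by (simp add: jet_add jet_sum jet_scale)
      moreover have "(\<Sum>b\<in>B. const_laurent (c (Inl b)) * (?y * f b (\<alpha> p) - jet ns (\<alpha> p) (\<kappa> b p))) +
          (\<Sum>x\<in>G. const_laurent (c (Inr x)) * (?y * \<gamma> x - jet ns (\<alpha> p) (\<mu> x p))) \<in> ?J"
        using \<kappa> \<mu> p
        by (intro double_point_ideal_add double_point_ideal_sum double_point_ideal_const) auto
      ultimately have "(\<Sum>b\<in>B. const_laurent (c (Inl b)) * (?y * f b (\<alpha> p))) +
          (\<Sum>x\<in>G. const_laurent (c (Inr x)) * (?y * \<gamma> x)) - jet ns (\<alpha> p) d \<in> ?J"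
        by (simp add: right_diff_distrib sum_subtractf algebra_simps)
      moreover have "?y * F (\<alpha> p) = (\<Sum>b\<in>B. const_laurent (c (Inl b)) * (?y * f b (\<alpha> p))) +
          (\<Sum>x\<in>G. const_laurent (c (Inr x)) * (?y * \<gamma> x))"
        unfolding F_def s_def by (simp add: distrib_left sum_distrib_left mult.left_commute)
      ultimately show ?thesis
        using \<open>jet ns (\<alpha> p) d = 0\<close> by simp
    qed
    \<comment> \<open>On the overlap with \<open>\<alpha> p\<close> the two values of
      \<open>F\<close> differ by cocycles of the ideal sheaf, so the condition passes to the overlap
      trivialised by \<open>a\<close> and then descends to the chart \<open>a\<close>.\<close>
    have FJ: "chart_section_inv ns a * F a \<in> double_point_ideal_sheaf ns p {a}"
      if p: "p \<in> S" and a: "a \<in> charts ns" for p a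
    proof (cases "p \<in> chart_points ns {a}")
      case False
      then show ?thesis
        using chart_section_inv_mult[OF a _ FL[OF a]] by (simp add: double_point_ideal_outside)
    next
      case True
      let ?J = "double_point_ideal_sheaf ns p {a, \<alpha> p}"
      have diff: "F (\<alpha> p) - F a = (\<Sum>b\<in>B. const_laurent (c (Inl b)) * b a (\<alpha> p))"
        using a \<alpha>(1)[OF p] by (rule F_diff)
      have "chart_section_inv ns a * b a (\<alpha> p) \<in> ?J" if "b \<in> B" for b
        using BF[OF that a \<alpha>(1)[OF p]] p by (subst (asm) twist_iff[OF a]) auto
      then have "(\<Sum>b\<in>B. const_laurent (c (Inl b)) * (chart_section_inv ns a * b a (\<alpha> p))) \<in> ?J"
        by (intro double_point_ideal_sum double_point_ideal_const)
      then have 1: "chart_section_inv ns a * (F (\<alpha> p) - F a) \<in> ?J"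
        unfolding diff by (simp add: sum_distrib_left mult.left_commute)
      have "chart_section_inv ns (\<alpha> p) * F (\<alpha> p) \<in> ?J"
        using F\<alpha>[OF p] double_point_ideal_mono[of "{\<alpha> p}" "{a, \<alpha> p}"] by blast
      then have "chart_section_inv ns a * F (\<alpha> p) \<in> ?J"
        by (rule double_point_ideal_change_chart[rotated 3]) (use a \<alpha>[OF p] in auto)
      then have "chart_section_inv ns a * F (\<alpha> p) - chart_section_inv ns a * (F (\<alpha> p) - F a) \<in> ?J"
        using 1 by (rule double_point_ideal_diff)
      then have "chart_section_inv ns a * F a \<in> ?J"
        by (simp add: right_diff_distrib)
      moreover have "p \<in> chart_points ns {a, \<alpha> p}"
        using True \<alpha>(2)[OF p] chart_points_insert[of p ns a "{\<alpha> p}"] by blast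
      ultimately show ?thesis
        using chart_section_inv_mult[OF a _ FL[OF a]]
        by (intro double_point_ideal_local[OF a, of "{a, \<alpha> p}"]) auto
    qed
    have "(\<Sum>b\<in>B. (\<lambda>a a'. const_laurent (c (Inl b)) * b a a')) =
        (\<lambda>a a'. if a \<in> charts ns \<and> a' \<in> charts ns then F a' - F a else 0)"
    proof (intro ext)
      fix a a'
      show "(\<Sum>b\<in>B. (\<lambda>a a'. const_laurent (c (Inl b)) * b a a')) a a' =
          (if a \<in> charts ns \<and> a' \<in> charts ns then F a' - F a else 0)"
      proof (cases "a \<in> charts ns \<and> a' \<in> charts ns")
        case True
        then show ?thesis
          unfolding sum_fun2_apply by (simp add: F_diff)
      next
        case False
        have "const_laurent (c (Inl b)) * b a a' = 0" if "b \<in> B" for b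
        proof -
          have "b a a' = 0"
            using B(2) that False unfolding cech_cocycles1_def by blast
          then show ?thesis by simp
        qed
        then have "(\<Sum>b\<in>B. const_laurent (c (Inl b)) * b a a') = 0"
          by (intro sum.neutral) blast
        then show ?thesis unfolding sum_fun2_apply using False by auto
      qed
    qed
    moreover have "F a \<in> ?F {a}" if a: "a \<in> charts ns" for a
      using FL[OF a] FJ[OF _ a] twist_iff[OF a, of "{a}"] by blast
    ultimately have "(\<Sum>b\<in>B. (\<lambda>a a'. const_laurent (c (Inl b)) * b a a')) \<in> cech_coboundaries1 (charts ns) ?F"
      unfolding cech_coboundaries1_def by blast
    \<comment> \<open>The cochain \<open>F\<close> has values in the ideal sheaf, so independence of
      the classes removes their coefficients; what remains is a global section with zero
      jets.\<close>
    then have cB: "\<forall>b\<in>B. c (Inl b) = 0" by (rule Bindep)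
    then have "F a = s" for a
      by (simp add: F_def const_laurent_hom)
    then have "\<forall>x\<in>G. c (Inr x) = 0"
      using FJ by (intro indep) (auto simp: s_def)
    then show False using c(1) cB by auto
  qed
qed

section \<open>Global sections with independent jets at one point\<close>

lemma line_bundle_regular:
  assumes "f \<in> line_bundle ns d A" "\<And>m k. m \<in> Poly_Mapping.keys f \<Longrightarrow> Poly_Mapping.lookup m k \<ge> 0"
  shows "f \<in> line_bundle ns d {}"
  unfolding line_bundle_iff
proof
  fix m assume m: "m \<in> Poly_Mapping.keys f"
  then have "\<not> Poly_Mapping.lookup m (i, j) < 0" for i j
    by (simp add: not_less assms(2))
  then show "admissible ns d {} m"
    using assms(1) m unfolding line_bundle_iff admissible_def by blast
qed

text \<open>Multiplying the chart monomial by an affine coordinate replaces one selected variable by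
  another variable of the same factor. No pole arises, so every jet at a point of the chart comes
  from a global section.\<close>

definition first_jet_section :: "nat list \<Rightarrow> (nat \<Rightarrow> nat) \<Rightarrow> (nat \<times> nat) option \<Rightarrow> 'k::field laurent" where
  "first_jet_section ns a t = chart_section ns a * jet_basis a t"

lemma first_jet_section_line_bundle:
  assumes a: "a \<in> charts ns" and t: "t \<in> jet_index ns a"
  shows "first_jet_section ns a t \<in> line_bundle ns (\<lambda>_. 1) {}"
proof (rule line_bundle_regular)
  have "jet_basis a t * chart_section ns a \<in> line_bundle ns (\<lambda>_. 1) {a}"
    using a t by (intro structure_sheaf_line_bundle_mult jet_basis_structure_sheaf chart_section_line_bundle) auto
  then show "first_jet_section ns a t \<in> line_bundle ns (\<lambda>_. 1) {a}"
    unfolding first_jet_section_def by (simp add: mult.commute)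
  fix m and k :: "nat \<times> nat" assume m: "m \<in> Poly_Mapping.keys (first_jet_section ns a t :: 'a laurent)"
  obtain i' j' where k: "k = (i', j')" by (cases k)
  show "Poly_Mapping.lookup m k \<ge> 0"
  proof (cases t)
    case None
    then have "m = chart_weight ns a"
      using m by (simp add: first_jet_section_def jet_basis_def chart_section_def)
    then show ?thesis unfolding k by (simp add: lookup_chart_weight)
  next
    case (Some ij)
    then obtain i j where ij: "t = Some (i, j)" "i < length ns" "j \<le> ns ! i"
      using t unfolding jet_index_def by auto
    then have "m = chart_weight ns a + (Poly_Mapping.single (i, j) 1 - Poly_Mapping.single (i, a i) 1)"
      using m by (simp add: first_jet_section_def jet_basis_def chart_section_def coord_ratio_def mult_single)
    then show ?thesis
      using ij unfolding k by (simp add: lookup_chart_weight lookup_add lookup_minus lookup_single when_def)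
  qed
qed

lemma sum_first_jet_section:
  "(\<Sum>t\<in>jet_index ns a. const_laurent (c t) * first_jet_section ns a t) = chart_section ns a * jet ns a c"
  by (simp add: first_jet_section_def jet_def sum_distrib_left mult.left_commute)

lemma chart_section_inv_cancel [simp]:
  "chart_section_inv ns a * (chart_section ns a * f) = f"
  by (simp flip: mult.assoc)

text \<open>The n+1 sections \<open>first_jet_section\<close> already have independent jets at
  \<open>p\<close>, whatever happens at the other points.\<close>

lemma h1_double_points_le_one_point:
  assumes S: "S \<subseteq> multiproj_space ns" "finite S" and p: "p \<in> S"
  shows "h1 ns (twist ns (\<lambda>_. 1) (double_points_ideal_sheaf ns S)) \<le>
    enat ((card S - 1) * (sum_list ns + 1))"
proof -
  obtain a where a: "a \<in> charts ns" "p \<in> chart_points ns {a}"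
    using chart_exists S p by blast
  have "h1 ns (twist ns (\<lambda>_. 1) (double_points_ideal_sheaf ns S)) \<le>
      enat (card S * (sum_list ns + 1) - card (jet_index ns a))"
  proof (rule h1_double_points_le[OF S finite_jet_index first_jet_section_line_bundle[OF a(1)]])
    fix c assume "\<And>p b. p \<in> S \<Longrightarrow> b \<in> charts ns \<Longrightarrow> p \<in> chart_points ns {b} \<Longrightarrow>
      chart_section_inv ns b * (\<Sum>t\<in>jet_index ns a. const_laurent (c t) * first_jet_section ns a t)
        \<in> double_point_ideal_sheaf ns p {b}"
    then have "jet ns a c \<in> double_point_ideal_sheaf ns p {a}"
      using p a by (fastforce simp: sum_first_jet_section)
    then show "\<forall>t\<in>jet_index ns a. c t = 0"
      using jet_eq_zero a(2) by blast
  qed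
  then show ?thesis
    by (simp only: card_jet_index[OF a(1)] diff_mult_distrib mult_1)
qed

section \<open>A further section on proper products\<close>

lemma admissible_variable:
  assumes "i < length ns" "j \<le> ns ! i"
  shows "admissible ns (\<lambda>i'. if i' = i then 1 else 0) A (Poly_Mapping.single (i, j) 1)"
proof -
  have "(\<Sum>j'\<le>ns ! i'. Poly_Mapping.lookup (Poly_Mapping.single (i, j) (1::int)) (i', j')) =
      (if i' = i then 1 else 0)" for i'
  proof (cases "i' = i")
    case True
    then have "(\<Sum>j'\<le>ns ! i'. Poly_Mapping.lookup (Poly_Mapping.single (i, j) (1::int)) (i', j')) =
        (\<Sum>j'\<le>ns ! i'. if j' = j then 1 else 0)"
      by (intro sum.cong) (auto simp: lookup_single when_def)
    then show ?thesis using True assms by simp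
  qed (simp add: lookup_single when_def)
  then show ?thesis
    using assms unfolding admissible_def by (auto simp: lookup_single when_def)
qed

text \<open>Up to the factor \<open>x (i, a i)\<close>, the affine coordinate minus
  \<open>c\<close>; with \<open>c\<close> the value of the coordinate at a point, the form vanishes
  there.\<close>

definition linear_form :: "(nat \<Rightarrow> nat) \<Rightarrow> nat \<Rightarrow> nat \<Rightarrow> 'k \<Rightarrow> 'k::field laurent" where
  "linear_form a i j c = Poly_Mapping.single (Poly_Mapping.single (i, j) 1) 1
     + Poly_Mapping.single (Poly_Mapping.single (i, a i) 1) (- c)"

lemma linear_form_line_bundle:
  assumes "a \<in> charts ns" "i < length ns" "j \<le> ns ! i"
  shows "linear_form a i j c \<in> line_bundle ns (\<lambda>i'. if i' = i then 1 else 0) A"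
  unfolding linear_form_def using assms chart_le[OF assms(1,2)]
  by (intro line_bundle_add line_bundle_single admissible_variable)

lemma linear_form_eq:
  "linear_form a i j c =
    Poly_Mapping.single (Poly_Mapping.single (i, a i) 1) 1 * (coord_ratio a i j - const_laurent c)"
  by (simp add: linear_form_def coord_ratio_def const_laurent_def right_diff_distrib mult_single
      single_uminus)

lemma monomial_value_variable: "monomial_value x (Poly_Mapping.single k 1) = x k"
  by (simp add: monomial_value_single)

lemma restrict_to_line_linear_form:
  "restrict_to_line v w (linear_form a i j c) =
    fls_const (v (i, j) - c * v (i, a i)) + fls_const (w (i, j) - c * w (i, a i)) * fls_X"
proof -
  have "restrict_to_line v w (linear_form a i j c) =
      line_germ v w (i, j) - fls_const c * line_germ v w (i, a i)"
    by (simp add: linear_form_def restrict_to_line_def laurent_value_add[OF field_hom_fls_const]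
        laurent_value_single[OF field_hom_fls_const] monomial_value_variable)
  then show ?thesis
    by (simp add: line_germ_def algebra_simps flip: fls_minus_const fls_const_mult_const)
qed

text \<open>
  The section is \<open>l\<^sub>1 l\<^sub>2 \<rho>\<close> with linear forms \<open>l\<^sub>1\<close>, \<open>l\<^sub>2\<close> from two different factors vanishing at \<open>p\<close>, where
  \<open>l\<^sub>1\<close> and \<open>\<rho>\<close> do not vanish at \<open>q\<close>. It does not vanish doubly at \<open>q\<close>, since \<open>l\<^sub>2\<close> has no
  critical point.
\<close>

lemma extra_section_exists:
  assumes p: "p \<in> multiproj_space ns" and q: "q \<in> multiproj_space ns" and "p \<noteq> q"
    and ns: "length ns \<ge> 2" "\<forall>m\<in>set ns. m > 0"
    and a: "a \<in> charts ns" "p \<in> chart_points ns {a}" and b: "b \<in> charts ns" "q \<in> chart_points ns {b}"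
  obtains h :: "'k::field laurent" where "h \<in> line_bundle ns (\<lambda>_. 1) {}"
    "chart_section_inv ns a * h \<in> double_point_ideal_sheaf ns p {a}"
    "chart_section_inv ns b * h \<notin> double_point_ideal_sheaf ns q {b}"
proof -
  obtain v where v: "representative ns p v" using p by (rule representative_exists)
  obtain w where w: "representative ns q w" using q by (rule representative_exists)
  have va: "v i (a i) \<noteq> 0" if "i < length ns" for i
    using chart_points_iff[OF p v, of "{a}"] a that by blast
  have wb: "w i (b i) \<noteq> 0" if "i < length ns" for i
    using chart_points_iff[OF q w, of "{b}"] b that by blast
  obtain i1 where i1: "i1 < length ns"
    "\<And>b. v i1 b \<noteq> 0 \<Longrightarrow> \<exists>j\<le>ns ! i1. v i1 b * w i1 j \<noteq> v i1 j * w i1 b"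
    using separating_coordinate[OF p q \<open>p \<noteq> q\<close> v w] by blast
  obtain j1 where j1: "j1 \<le> ns ! i1" "v i1 (a i1) * w i1 j1 \<noteq> v i1 j1 * w i1 (a i1)"
    using i1(2)[OF va[OF i1(1)]] by blast
  \<comment> \<open>A second factor, available because there are at least two.\<close>
  define i2 where "i2 = (if i1 = 0 then 1 else 0 :: nat)"
  have i2: "i2 < length ns" "i2 \<noteq> i1" using ns by (auto simp: i2_def)
  \<comment> \<open>A coordinate not selected by \<open>a\<close>; it exists because the factor has
    positive dimension.\<close>
  define j2 where "j2 = (if a i2 = 0 then 1 else 0 :: nat)"
  have "ns ! i2 > 0" using ns(2) i2(1) by simp
  then have j2: "j2 \<le> ns ! i2" "j2 \<noteq> a i2" by (auto simp: j2_def)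
  define c1 where "c1 = v i1 j1 / v i1 (a i1)"
  define c2 where "c2 = v i2 j2 / v i2 (a i2)"
  define T where "T = {..<length ns} - {i1, i2}"
  \<comment> \<open>The remaining factors each contribute the variable selected by the chart of
    \<open>q\<close>, which is nonzero at \<open>q\<close>; this fills the multidegree up to
    (1,...,1).\<close>
  define r where "r = (\<Sum>i\<in>T. Poly_Mapping.single (i, b i) (1::int))"
  define \<rho> :: "'k laurent" where "\<rho> = Poly_Mapping.single r 1"
  define l1 where "l1 = linear_form a i1 j1 c1"
  define l2 where "l2 = linear_form a i2 j2 c2"
  define h where "h = l1 * l2 * \<rho>"
  have lkr: "Poly_Mapping.lookup r (i, j) = (if i \<in> T \<and> j = b i then 1 else 0)" for i j
  proof -
    have "Poly_Mapping.lookup r (i, j) = (\<Sum>i'\<in>T. if i' = i then (if j = b i then 1 else 0) else 0)"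
      unfolding r_def lookup_sum lookup_single by (intro sum.cong) (auto simp: when_def)
    then show ?thesis by (simp add: T_def)
  qed
  have T: "i < length ns" if "i \<in> T" for i using that by (simp add: T_def)
  have "admissible ns (\<lambda>i. if i \<in> T then 1 else 0) A r" for A
    using T chart_le[OF b(1)] unfolding admissible_def
    by (auto simp: lkr in_keys_iff split: if_splits)
  then have \<rho>L: "\<rho> \<in> line_bundle ns (\<lambda>i. if i \<in> T then 1 else 0) A" for A
    unfolding \<rho>_def by (rule line_bundle_single)
  have l1L: "l1 \<in> line_bundle ns (\<lambda>i'. if i' = i1 then 1 else 0) A" for A
    unfolding l1_def using a(1) i1(1) j1(1) by (rule linear_form_line_bundle)
  have l2L: "l2 \<in> line_bundle ns (\<lambda>i'. if i' = i2 then 1 else 0) A" for A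
    unfolding l2_def using a(1) i2(1) j2(1) by (rule linear_form_line_bundle)
  have l12L: "l1 * l2 \<in> line_bundle ns (\<lambda>i. if i = i1 \<or> i = i2 then 1 else 0) A" for A
    using l1L l2L by (rule line_bundle_mult) (use i2 in auto)
  have hL: "h \<in> line_bundle ns (\<lambda>_. 1) A" for A
    unfolding h_def using l12L \<rho>L by (rule line_bundle_mult) (auto simp: T_def)
  have hp: "chart_section_inv ns a * h \<in> double_point_ideal_sheaf ns p {a}"
  proof -
    let ?z = "\<lambda>i j c. coord_ratio a i j - const_laurent c :: 'k laurent"
    define x :: "'k laurent" where "x = Poly_Mapping.single (Poly_Mapping.single (i1, a i1) 1) 1
      * Poly_Mapping.single (Poly_Mapping.single (i2, a i2) 1) 1"
    have x: "x \<in> line_bundle ns (\<lambda>i. if i = i1 \<or> i = i2 then 1 else 0) {a}"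
      unfolding x_def
      by (rule line_bundle_mult[OF line_bundle_single[OF admissible_variable] line_bundle_single[OF admissible_variable]])
        (use i1(1) i2 chart_le[OF a(1)] in auto)
    have "x * \<rho> \<in> line_bundle ns (\<lambda>_. 1) {a}"
      using x \<rho>L by (rule line_bundle_mult) (auto simp: T_def)
    then have "chart_section_inv ns a * (x * \<rho>) \<in> structure_sheaf ns {a}"
      using a by (intro chart_section_inv_mult) auto
    moreover have "?z i1 j1 c1 * ?z i2 j2 c2 \<in> double_point_ideal_sheaf ns p {a}"
      unfolding c1_def c2_def
      by (intro double_point_ideal_intro coord_ratio_point_ideal) (use a v i1(1) i2 j1 j2 in auto)
    ultimately have "chart_section_inv ns a * (x * \<rho>) * (?z i1 j1 c1 * ?z i2 j2 c2)
        \<in> double_point_ideal_sheaf ns p {a}"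
      by (rule double_point_ideal_mult)
    moreover have "chart_section_inv ns a * h =
        chart_section_inv ns a * (x * \<rho>) * (?z i1 j1 c1 * ?z i2 j2 c2)"
      unfolding h_def l1_def l2_def linear_form_eq x_def by (simp only: mult_ac)
    ultimately show ?thesis by simp
  qed
  have "chart_section_inv ns b * h \<notin> double_point_ideal_sheaf ns q {b}"
  proof
    \<comment> \<open>The direction moves only the coordinate \<open>(i2, j2)\<close>:
      \<open>l1\<close> stays at its nonzero value and \<open>l2\<close> has slope 1, so after
      dividing by the unit coming from \<open>\<rho>\<close> the coefficient of X is the value of
      \<open>l1\<close> at \<open>q\<close>.\<close>
    define d where "d i j = (if i = i2 \<and> j = j2 then 1 else 0 :: 'k)" for i j
    let ?E = "restrict_to_line (coords w) (coords d)"
    assume *: "chart_section_inv ns b * h \<in> double_point_ideal_sheaf ns q {b}"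
    have defd: "defined_at (coords w) f" if "f \<in> line_bundle ns e {b}" for f :: "'k laurent" and e
      using b(2) w that by (rule defined_at_representative)
    have "h = chart_section ns b * (chart_section_inv ns b * h)"
      by (simp flip: mult.assoc)
    then have "?E h = ?E (chart_section ns b) * ?E (chart_section_inv ns b * h)"
      using restrict_to_line_mult[OF defd[OF chart_section_line_bundle[OF b(1)]]
          defd[OF chart_section_inv_mult[OF b(1) _ hL, unfolded structure_sheaf_def]], of "coords d"] by simp
    moreover have "vanishes_doubly (?E (chart_section ns b) * ?E (chart_section_inv ns b * h))"
      using double_point_ideal_vanishes_doubly[OF b(2) w *]
        restrict_to_line_extends[OF defd[OF chart_section_line_bundle[OF b(1)]]]
      by (rule vanishes_doubly_mult_extends)
    moreover have "?E h = ?E l1 * ?E l2 * ?E \<rho>"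
      unfolding h_def
      by (simp add: restrict_to_line_mult[OF defd[OF l12L] defd[OF \<rho>L]]
          restrict_to_line_mult[OF defd[OF l1L] defd[OF l2L]])
    ultimately have vd: "vanishes_doubly (?E l1 * ?E l2 * ?E \<rho>)" by simp
    have \<rho>w: "value_at w \<rho> \<noteq> 0"
    proof -
      have "w i j powi Poly_Mapping.lookup r (i, j) \<noteq> 0" for i j
        using T wb by (simp add: lkr power_int_not_zero)
      then show ?thesis
        by (simp add: \<rho>_def laurent_value_single[OF field_hom_id] monomial_value_def split: prod.splits)
    qed
    have E\<rho>: "fls_extends (?E \<rho>) (value_at w \<rho>)"
      by (rule restrict_to_line_extends[OF defd[OF \<rho>L]])
    have "?E \<rho> \<noteq> 0"
      using E\<rho> \<rho>w unfolding fls_extends_def by auto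
    have "vanishes_doubly (inverse (?E \<rho>) * (?E l1 * ?E l2 * ?E \<rho>))"
      using vd fls_extends_inverse[OF E\<rho> \<rho>w] by (rule vanishes_doubly_mult_extends)
    moreover have "inverse (?E \<rho>) * (?E l1 * ?E l2 * ?E \<rho>) = ?E l1 * ?E l2"
      using \<open>?E \<rho> \<noteq> 0\<close> by (simp add: field_simps)
    ultimately have "vanishes_doubly (?E l1 * ?E l2)" by simp
    moreover have "?E l1 = fls_const (w i1 j1 - c1 * w i1 (a i1))"
      using i2 by (simp add: l1_def restrict_to_line_linear_form d_def)
    moreover have "?E l2 = fls_const (w i2 j2 - c2 * w i2 (a i2)) + fls_const 1 * fls_X"
      using j2 by (simp add: l2_def restrict_to_line_linear_form d_def)
    ultimately have "vanishes_doubly (fls_const ((w i1 j1 - c1 * w i1 (a i1)) * (w i2 j2 - c2 * w i2 (a i2)))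
        + fls_const (w i1 j1 - c1 * w i1 (a i1)) * fls_X)"
      by (simp add: distrib_left)
    then have "w i1 j1 - c1 * w i1 (a i1) = 0" by (rule vanishes_doubly_line)
    then show False
      using j1(2) va[OF i1(1)] by (simp add: c1_def field_simps)
  qed
  then show ?thesis using that hL hp by blast
qed

text \<open>The extra section \<open>h\<close> is added to the n+1 sections attached to
  \<open>p\<close>. Since \<open>h\<close> has zero jet at \<open>p\<close>, the point
  \<open>p\<close> kills the other coefficients first, and then \<open>q\<close> kills that of
  \<open>h\<close>.\<close>

lemma h1_double_points_less:
  assumes S: "S \<subseteq> multiproj_space ns" "finite S" and pq: "p \<in> S" "q \<in> S" "p \<noteq> q"
    and ns: "length ns \<ge> 2" "\<forall>m\<in>set ns. m > 0"
  shows "h1 ns (twist ns (\<lambda>_. 1) (double_points_ideal_sheaf ns S)) <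
    enat ((card S - 1) * (sum_list ns + 1))"
proof -
  obtain a where a: "a \<in> charts ns" "p \<in> chart_points ns {a}"
    using chart_exists S pq by blast
  obtain b where b: "b \<in> charts ns" "q \<in> chart_points ns {b}"
    using chart_exists S pq by blast
  obtain h :: "'a laurent" where h: "h \<in> line_bundle ns (\<lambda>_. 1) {}"
    "chart_section_inv ns a * h \<in> double_point_ideal_sheaf ns p {a}"
    "chart_section_inv ns b * h \<notin> double_point_ideal_sheaf ns q {b}"
    using extra_section_exists[OF _ _ pq(3) ns a b] S pq by blast
  define G where "G = insert None (Some ` jet_index ns a)"
  define \<gamma> where "\<gamma> x = (case x of None \<Rightarrow> h | Some t \<Rightarrow> first_jet_section ns a t)" for x
  have finG: "finite G" unfolding G_def using finite_jet_index by blast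
  have cardG: "card G = sum_list ns + 2"
    unfolding G_def using finite_jet_index[of ns a] card_jet_index[OF a(1)]
    by (subst card_insert_disjoint) (auto simp: card_image)
  have sumG: "(\<Sum>x\<in>G. const_laurent (c x) * \<gamma> x) =
      const_laurent (c None) * h + chart_section ns a * jet ns a (\<lambda>t. c (Some t))" for c
    unfolding G_def using finite_jet_index[of ns a]
    by (subst sum.insert) (auto simp: sum.reindex \<gamma>_def simp flip: sum_first_jet_section)
  have "h1 ns (twist ns (\<lambda>_. 1) (double_points_ideal_sheaf ns S)) \<le>
      enat (card S * (sum_list ns + 1) - card G)"
  proof (rule h1_double_points_le[OF S finG])
    show "\<gamma> x \<in> line_bundle ns (\<lambda>_. 1) {}" if "x \<in> G" for x
      using that h(1) first_jet_section_line_bundle[OF a(1)] by (auto simp: G_def \<gamma>_def)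
    fix c assume c: "\<And>p a'. p \<in> S \<Longrightarrow> a' \<in> charts ns \<Longrightarrow> p \<in> chart_points ns {a'} \<Longrightarrow>
      chart_section_inv ns a' * (\<Sum>x\<in>G. const_laurent (c x) * \<gamma> x) \<in> double_point_ideal_sheaf ns p {a'}"
    let ?j = "jet ns a (\<lambda>t. c (Some t))"
    have "const_laurent (c None) * (chart_section_inv ns a * h) + ?j \<in> double_point_ideal_sheaf ns p {a}"
      using c[OF pq(1) a] unfolding sumG
      by (simp add: distrib_left mult.left_commute[of _ "const_laurent (c None)"])
    then have "const_laurent (c None) * (chart_section_inv ns a * h) + ?j
        - const_laurent (c None) * (chart_section_inv ns a * h) \<in> double_point_ideal_sheaf ns p {a}"
      by (rule double_point_ideal_diff[OF _ double_point_ideal_const[OF h(2)]])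
    then have "?j \<in> double_point_ideal_sheaf ns p {a}" by simp
    then have Some: "c (Some t) = 0" if "t \<in> jet_index ns a" for t
      using jet_eq_zero[OF _ a(2) _ that] by blast
    then have "?j = 0" unfolding jet_def by (simp add: const_laurent_hom)
    then have "const_laurent (c None) * (chart_section_inv ns b * h) \<in> double_point_ideal_sheaf ns q {b}"
      using c[OF pq(2) b] unfolding sumG by (simp add: mult.left_commute)
    then have "const_laurent (inverse (c None)) * (const_laurent (c None) * (chart_section_inv ns b * h))
        \<in> double_point_ideal_sheaf ns q {b}"
      by (rule double_point_ideal_const)
    moreover have "const_laurent (inverse (c None)) * (const_laurent (c None) * (chart_section_inv ns b * h)) =
        chart_section_inv ns b * h" if "c None \<noteq> 0"
      using that by (simp flip: mult.assoc const_laurent_hom(3)) (simp add: const_laurent_hom)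
    ultimately have "c None = 0" using h(3) by metis
    then show "\<forall>x\<in>G. c x = 0" using Some by (auto simp: G_def)
  qed
  moreover have "card S * (sum_list ns + 1) - card G < (card S - 1) * (sum_list ns + 1)"
  proof -
    have "card {p, q} \<le> card S" using S pq by (intro card_mono) auto
    \<comment> \<open>Two points are needed for the strict inequality: with a single one both sides
      would truncate to 0.\<close>
    then have "card S = Suc (Suc (card S - 2))"
      using pq(3) by simp
    then obtain s where "card S = Suc (Suc s)" by blast
    then show ?thesis by (simp add: cardG)
  qed
  ultimately show ?thesis
    by (metis enat_ord_simps(2) order_le_less_trans)
qed

section \<open>The lower bound on projective space\<close>

lemma jet_basis_combination:
  assumes "finite X" "\<And>x. x \<in> X \<Longrightarrow> t x \<in> jet_index ns a"
  shows "(\<Sum>x\<in>X. const_laurent (c x) * jet_basis a (t x)) =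
    jet ns a (\<lambda>s. \<Sum>x\<in>X. c x * (if s = t x then 1 else 0))"
  unfolding jet_sum jet_scale using assms by (intro sum.cong refl) (simp add: jet_single)

text \<open>A monomial regular on all charts has no negative exponent, so degree 1 leaves a single
  variable, which is the chart monomial times a member of the jet basis. With several factors the
  monomials of multidegree (1,...,1) outnumber the n+1 jets, and this is what separates the two
  cases.\<close>

lemma global_section_eq_jet:
  assumes n: "n > 0" and a: "a \<in> charts [n]"
    and G: "\<And>b. b \<in> charts [n] \<Longrightarrow> G \<in> line_bundle [n] (\<lambda>_. 1) {b}"
  shows "\<exists>c. G = chart_section [n] a * jet [n] a c"
proof -
  have mono: "\<exists>t\<in>jet_index [n] a. Poly_Mapping.single m 1 = (chart_section [n] a * jet_basis a t :: 'a laurent)"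
    if m: "m \<in> Poly_Mapping.keys G" for m
  proof -
    have adm: "admissible [n] (\<lambda>_. 1) {b} m" if "b \<in> charts [n]" for b
      using G[OF that] m unfolding line_bundle_iff by blast
    have supp: "i = 0 \<and> j \<le> n" if "Poly_Mapping.lookup m (i, j) \<noteq> 0" for i j
    proof -
      have "(i, j) \<in> Poly_Mapping.keys m" using that by (simp add: in_keys_iff)
      then show ?thesis using adm[OF a] unfolding admissible_def by auto
    qed
    have nonneg: "Poly_Mapping.lookup m (i, j) \<ge> 0" for i j
    proof (rule ccontr)
      assume neg: "\<not> ?thesis"
      have i: "i = 0" using supp[of i j] neg by simp
      \<comment> \<open>A chart that does not select the variable \<open>j\<close>, available since
        \<open>n > 0\<close>, forbids a pole along it.\<close>
      define b where "b = restrict (\<lambda>_. if j = 0 then 1 else 0 :: nat) {..<length [n]}"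
      have "b \<in> charts [n]" using n unfolding charts_def b_def by auto
      then have "j = b i" using adm[of b] neg unfolding admissible_def by force
      then show False using i by (simp add: b_def split: if_splits)
    qed
    have sum1: "(\<Sum>j\<le>n. Poly_Mapping.lookup m (0, j)) = 1"
      using adm[OF a] unfolding admissible_def by simp
    then obtain j where j: "j \<le> n" "Poly_Mapping.lookup m (0, j) \<noteq> 0"
      by (metis atMost_iff sum.neutral zero_neq_one)
    have split: "Poly_Mapping.lookup m (0, j) + (\<Sum>j'\<in>{..n} - {j}. Poly_Mapping.lookup m (0, j')) = 1"
      using sum1 j(1) by (subst (asm) sum.remove[of _ j]) auto
    have rest: "(\<Sum>j'\<in>{..n} - {j}. Poly_Mapping.lookup m (0, j')) \<ge> 0"
      by (intro sum_nonneg nonneg)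
    have one: "Poly_Mapping.lookup m (0, j) = 1"
      using split rest j(2) nonneg[of 0 j] by linarith
    then have "(\<Sum>j'\<in>{..n} - {j}. Poly_Mapping.lookup m (0, j')) = 0"
      using split by simp
    then have zero: "Poly_Mapping.lookup m (0, j') = 0" if "j' \<le> n" "j' \<noteq> j" for j'
      using that nonneg by (subst (asm) sum_nonneg_eq_0_iff) auto
    have m_eq: "m = Poly_Mapping.single (0, j) 1"
    proof (rule poly_mapping_eqI)
      fix k :: "nat \<times> nat"
      obtain i' j' where k: "k = (i', j')" by (cases k)
      show "Poly_Mapping.lookup m k = Poly_Mapping.lookup (Poly_Mapping.single (0, j) 1) k"
        using supp[of i' j'] zero[of j'] one unfolding k by (auto simp: lookup_single when_def)
    qed
    have weight: "chart_weight [n] a = Poly_Mapping.single (0, a 0) 1"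
      by (simp add: chart_weight_def)
    show ?thesis
    proof (cases "j = a 0")
      case True
      then show ?thesis
        by (intro bexI[of _ None]) (simp_all add: m_eq weight chart_section_def jet_basis_def jet_index_def)
    next
      case False
      then show ?thesis using j(1)
        by (intro bexI[of _ "Some (0, j)"])
          (simp_all add: m_eq weight chart_section_def jet_basis_def jet_index_def coord_ratio_def mult_single)
    qed
  qed
  then obtain t where t: "\<And>m. m \<in> Poly_Mapping.keys G \<Longrightarrow> t m \<in> jet_index [n] a"
    "\<And>m. m \<in> Poly_Mapping.keys G \<Longrightarrow> Poly_Mapping.single m 1 = (chart_section [n] a * jet_basis a (t m) :: 'a laurent)"
    by metis
  have "G = (\<Sum>m\<in>Poly_Mapping.keys G. const_laurent (Poly_Mapping.lookup G m) * Poly_Mapping.single m 1)"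
    by (subst laurent_expansion[of G]) (simp add: const_laurent_def mult_single)
  also have "\<dots> = (\<Sum>m\<in>Poly_Mapping.keys G. const_laurent (Poly_Mapping.lookup G m) * (chart_section [n] a * jet_basis a (t m)))"
    by (intro sum.cong refl) (simp add: t(2))
  also have "\<dots> = chart_section [n] a *
      (\<Sum>m\<in>Poly_Mapping.keys G. const_laurent (Poly_Mapping.lookup G m) * jet_basis a (t m))"
    by (simp add: sum_distrib_left mult.left_commute)
  also have "\<dots> = chart_section [n] a *
      jet [n] a (\<lambda>s. \<Sum>m\<in>Poly_Mapping.keys G. Poly_Mapping.lookup G m * (if s = t m then 1 else 0))"
    using t(1) by (subst jet_basis_combination[where ns = "[n]"]) auto
  finally show ?thesis by blast
qed

text \<open>Some affine coordinate takes different values \<open>c\<close> at \<open>p\<close> and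
  \<open>d\<close> at \<open>q\<close>; \<open>t\<close> is the affine function of it that
  interpolates 1 and 0.\<close>

lemma point_ideals_coprime:
  assumes p: "p \<in> chart_points ns {a}" and q: "q \<in> chart_points ns {a}" and "p \<noteq> q"
    and a: "a \<in> charts ns"
  obtains t where "t \<in> structure_sheaf ns {a}" "t \<in> point_ideal_sheaf ns q {a}" "1 - t \<in> point_ideal_sheaf ns p {a}"
proof -
  have pm: "p \<in> multiproj_space ns" and qm: "q \<in> multiproj_space ns"
    using p q by (simp_all add: chart_points_def)
  obtain v where v: "representative ns p v" using pm by (rule representative_exists)
  obtain w where w: "representative ns q w" using qm by (rule representative_exists)
  obtain i where i: "i < length ns"
    "\<And>b. v i b \<noteq> 0 \<Longrightarrow> \<exists>j\<le>ns ! i. v i b * w i j \<noteq> v i j * w i b"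
    using separating_coordinate[OF pm qm \<open>p \<noteq> q\<close> v w] by blast
  have va: "v i (a i) \<noteq> 0" using chart_points_iff[OF pm v, of "{a}"] p i(1) by blast
  have wa: "w i (a i) \<noteq> 0" using chart_points_iff[OF qm w, of "{a}"] q i(1) by blast
  obtain j where j: "j \<le> ns ! i" "v i (a i) * w i j \<noteq> v i j * w i (a i)"
    using i(2)[OF va] by blast
  define c where "c = v i j / v i (a i)"
  define d where "d = w i j / w i (a i)"
  have cd: "c - d \<noteq> 0" using va wa j(2) by (simp add: c_def d_def field_simps)
  define t where "t = const_laurent (1 / (c - d)) * (coord_ratio a i j - const_laurent d)"
  have tq: "t \<in> point_ideal_sheaf ns q {a}"
    unfolding t_def d_def using a q w i(1) j(1)
    by (intro point_ideal_mult structure_sheaf_const coord_ratio_point_ideal) auto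
  have "const_laurent (- (1 / (c - d))) * (coord_ratio a i j - const_laurent c) \<in> point_ideal_sheaf ns p {a}"
    unfolding c_def using a p v i(1) j(1)
    by (intro point_ideal_mult structure_sheaf_const coord_ratio_point_ideal) auto
  moreover have "1 - t = const_laurent (- (1 / (c - d))) * (coord_ratio a i j - const_laurent c)"
  proof -
    have "const_laurent (1 / (c - d)) * const_laurent c - const_laurent (1 / (c - d)) * const_laurent d = 1"
      using cd by (simp add: divide_simps flip: const_laurent_hom(2,3)) (simp add: const_laurent_hom flip: diff_divide_distrib)
    moreover have "const_laurent (- (1 / (c - d))) = - const_laurent (1 / (c - d))"
      by (simp add: const_laurent_def single_uminus)
    ultimately show ?thesis by (simp add: t_def algebra_simps)
  qed
  ultimately show ?thesis using that[of t] tq by (simp add: point_ideal_iff)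
qed

text \<open>If \<open>t\<close> is \<open>0\<close> at \<open>q\<close> and \<open>1\<close> at \<open>p\<close>, then \<open>t\<^sup>2 (2 - t\<^sup>2) = 1 - (1 - t\<^sup>2)\<^sup>2\<close> is \<open>0\<close> to second order
  at \<open>q\<close> and \<open>1\<close> to second order at \<open>p\<close>.\<close>

lemma double_points_separated:
  assumes p: "p \<in> chart_points ns {a}" and "p \<noteq> q" and a: "a \<in> charts ns"
  obtains u where "u \<in> structure_sheaf ns {a}" "u - 1 \<in> double_point_ideal_sheaf ns p {a}"
    "u \<in> double_point_ideal_sheaf ns q {a}"
proof (cases "q \<in> chart_points ns {a}")
  case False
  then show ?thesis
    by (intro that[of 1])
      (simp_all add: double_point_ideal_outside double_point_ideal_zero structure_sheaf_one)
next
  case True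
  obtain t where t: "t \<in> structure_sheaf ns {a}" "t \<in> point_ideal_sheaf ns q {a}"
      "1 - t \<in> point_ideal_sheaf ns p {a}"
    by (rule point_ideals_coprime[OF p True assms(2,3)])
  define s where "s = (1 + t) * (1 - t)"
  define u where "u = (1 + s) * (t * t)"
  have sR: "s \<in> structure_sheaf ns {a}"
    unfolding s_def using t(1)
    by (intro structure_sheaf_mult structure_sheaf_add structure_sheaf_diff structure_sheaf_one)
  have "s \<in> point_ideal_sheaf ns p {a}"
    unfolding s_def using t by (intro point_ideal_mult structure_sheaf_add structure_sheaf_one)
  then have "const_laurent (- 1) * (s * s) \<in> double_point_ideal_sheaf ns p {a}"
    by (intro double_point_ideal_const double_point_ideal_intro)
  moreover have "const_laurent (- 1) * (s * s) = u - 1"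
    by (simp add: u_def s_def const_laurent_def single_uminus algebra_simps)
  moreover have "u \<in> double_point_ideal_sheaf ns q {a}"
    unfolding u_def using t sR
    by (intro double_point_ideal_mult double_point_ideal_intro structure_sheaf_add structure_sheaf_one)
  moreover have "u \<in> structure_sheaf ns {a}"
    using calculation(3) double_point_ideal_subset by blast
  ultimately show ?thesis using that by simp
qed

text \<open>The Chinese remainder theorem for double points: multiply the functions that separate
  \<open>p\<close> from each of the other points.\<close>

lemma double_point_idempotent_exists:
  assumes "finite S" and p: "p \<in> chart_points ns {a}" and a: "a \<in> charts ns"
  shows "\<exists>u. u \<in> structure_sheaf ns {a} \<and> u - 1 \<in> double_point_ideal_sheaf ns p {a} \<and>
    (\<forall>q\<in>S - {p}. u \<in> double_point_ideal_sheaf ns q {a})"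
  using assms(1)
proof (induction S rule: finite_induct)
  case empty
  show ?case
    by (intro exI[of _ 1]) (simp add: structure_sheaf_one double_point_ideal_zero)
next
  case (insert q S)
  then obtain u where u: "u \<in> structure_sheaf ns {a}" "u - 1 \<in> double_point_ideal_sheaf ns p {a}"
    "\<forall>q\<in>S - {p}. u \<in> double_point_ideal_sheaf ns q {a}" by blast
  show ?case
  proof (cases "q = p")
    case True
    then show ?thesis using u by (intro exI[of _ u]) auto
  next
    case False
    then obtain w where w: "w \<in> structure_sheaf ns {a}" "w - 1 \<in> double_point_ideal_sheaf ns p {a}"
      "w \<in> double_point_ideal_sheaf ns q {a}"
      using double_points_separated[OF p _ a, of q] by metis
    have "u * (w - 1) + (u - 1) \<in> double_point_ideal_sheaf ns p {a}"
      using u w by (intro double_point_ideal_add double_point_ideal_mult)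
    then have "u * w - 1 \<in> double_point_ideal_sheaf ns p {a}"
      by (simp add: algebra_simps)
    moreover have "u * w \<in> structure_sheaf ns {a}" using u w by (intro structure_sheaf_mult)
    moreover have "u * w \<in> double_point_ideal_sheaf ns q' {a}" if "q' \<in> insert q S - {p}" for q'
    proof (cases "q' = q")
      case True
      then show ?thesis using u w by (simp add: double_point_ideal_mult)
    next
      case False
      then have "w * u \<in> double_point_ideal_sheaf ns q' {a}"
        using u w that by (intro double_point_ideal_mult) auto
      then show ?thesis by (simp add: mult.commute)
    qed
    ultimately show ?thesis by blast
  qed
qed

text \<open>
  Glueing local sections with prescribed jets at one point of \<open>S\<close> and zero jets at the others gives
  cocycles of the ideal sheaf. They bound only if the prescribed jets come from a global section;
  a linear form is determined by its jet at one point \<open>p\<^sub>0\<close>, so prescribing jet zero at \<open>p\<^sub>0\<close> and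
  arbitrary jets elsewhere yields independent classes.
\<close>

lemma h1_double_points_ge:
  fixes S :: "(nat \<Rightarrow> (nat \<Rightarrow> 'k::field) set) set"
  assumes n: "n > 0" and S: "S \<subseteq> multiproj_space [n]" "finite S" and p0: "p0 \<in> S"
  shows "enat ((card S - 1) * (n + 1)) \<le> h1 [n] (twist [n] (\<lambda>_. 1) (double_points_ideal_sheaf [n] S))"
proof -
  let ?ns = "[n]"
  let ?F = "twist ?ns (\<lambda>_. 1) (double_points_ideal_sheaf ?ns S)"
  let ?L = "line_bundle ?ns (\<lambda>_. 1)"
  let ?J = "double_point_ideal_sheaf ?ns"
  let ?y = "\<lambda>a. chart_section_inv ?ns a :: 'k laurent"
  have "\<forall>p\<in>S. \<exists>a. a \<in> charts ?ns \<and> p \<in> chart_points ?ns {a}"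
    using S chart_exists by blast
  then obtain \<alpha> where \<alpha>: "\<And>p. p \<in> S \<Longrightarrow> \<alpha> p \<in> charts ?ns" "\<And>p. p \<in> S \<Longrightarrow> p \<in> chart_points ?ns {\<alpha> p}"
    by metis
  define u where "u p a = (SOME w. w \<in> structure_sheaf ?ns {a} \<and> w - 1 \<in> ?J p {a} \<and>
    (\<forall>q\<in>S - {p}. w \<in> ?J q {a}))" for p a
  have "u p a \<in> structure_sheaf ?ns {a} \<and> u p a - 1 \<in> ?J p {a} \<and> (\<forall>q\<in>S - {p}. u p a \<in> ?J q {a})"
    if "a \<in> charts ?ns" "p \<in> chart_points ?ns {a}" for p a
    unfolding u_def by (rule someI_ex[OF double_point_idempotent_exists[OF S(2) that(2,1)]])
  then have u: "\<And>p a. a \<in> charts ?ns \<Longrightarrow> p \<in> chart_points ?ns {a} \<Longrightarrow> u p a \<in> structure_sheaf ?ns {a}"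
    "\<And>p a. a \<in> charts ?ns \<Longrightarrow> p \<in> chart_points ?ns {a} \<Longrightarrow> u p a - 1 \<in> ?J p {a}"
    "\<And>p a q. a \<in> charts ?ns \<Longrightarrow> p \<in> chart_points ?ns {a} \<Longrightarrow> q \<in> S \<Longrightarrow> q \<noteq> p \<Longrightarrow> u p a \<in> ?J q {a}"
    by blast+
  \<comment> \<open>One class for each point other than \<open>p0\<close> and each jet coefficient
    there; omitting \<open>p0\<close> accounts for the factor \<open>card S - 1\<close>.\<close>
  define X where "X = (SIGMA p:S - {p0}. jet_index ?ns (\<alpha> p))"
  have finX: "finite X" unfolding X_def using S finite_jet_index by auto
  have cardX: "card X = (card S - 1) * (n + 1)"
  proof -
    have "card X = (\<Sum>p\<in>S - {p0}. card (jet_index ?ns (\<alpha> p)))"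
      unfolding X_def by (rule card_SigmaI) (use S finite_jet_index in auto)
    then show ?thesis using \<alpha>(1) card_jet_index p0 by simp
  qed
  define \<gamma> :: "(nat \<Rightarrow> (nat \<Rightarrow> 'k) set) \<times> (nat \<times> nat) option \<Rightarrow> 'k laurent"
    where "\<gamma> x = first_jet_section ?ns (\<alpha> (fst x)) (snd x)" for x
  have X: "fst x \<in> S" "fst x \<noteq> p0" "snd x \<in> jet_index ?ns (\<alpha> (fst x))" if "x \<in> X" for x
    using that unfolding X_def by auto
  have \<gamma>L: "\<gamma> x \<in> ?L A" if "x \<in> X" for x A
    using first_jet_section_line_bundle[OF \<alpha>(1)[OF X(1)[OF that]] X(3)[OF that]]
      line_bundle_mono[of "{}" A ?ns] unfolding \<gamma>_def by blast
  \<comment> \<open>A local section with the jet of \<open>\<gamma> x\<close> at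
    \<open>fst x\<close> and zero jets at the rest of \<open>S\<close>. On charts missing
    \<open>fst x\<close> there is nothing to prescribe, and 0 serves.\<close>
  define \<phi> where "\<phi> x a = (if fst x \<in> chart_points ?ns {a} then u (fst x) a * \<gamma> x else 0)" for x a
  have \<phi>L: "\<phi> x a \<in> ?L {a}" if "x \<in> X" "a \<in> charts ?ns" for x a
    using structure_sheaf_line_bundle_mult[OF u(1)[OF that(2)] \<gamma>L[OF that(1)]]
    by (simp add: \<phi>_def)
  have y\<gamma>: "?y a * \<gamma> x \<in> structure_sheaf ?ns A" if "x \<in> X" "a \<in> charts ?ns" "a \<in> A" for x a A
    using chart_section_inv_mult[OF that(2,3) \<gamma>L[OF that(1)]] .
  have \<phi>_other: "?y a * \<phi> x a \<in> ?J q {a}" if "x \<in> X" "a \<in> charts ?ns" "q \<in> S" "q \<noteq> fst x" for x a q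
  proof (cases "fst x \<in> chart_points ?ns {a}")
    case True
    have "(?y a * \<gamma> x) * u (fst x) a \<in> ?J q {a}"
      using y\<gamma>[OF that(1,2), of "{a}"] u(3)[OF that(2) True that(3,4)]
      by (intro double_point_ideal_mult) auto
    then show ?thesis using True by (simp add: \<phi>_def mult_ac)
  qed (simp add: \<phi>_def double_point_ideal_zero)
  have \<phi>_same: "?y a * (\<phi> x a - \<gamma> x) \<in> ?J (fst x) {a}"
    if "x \<in> X" "a \<in> charts ?ns" "fst x \<in> chart_points ?ns {a}" for x a
  proof -
    have "(?y a * \<gamma> x) * (u (fst x) a - 1) \<in> ?J (fst x) {a}"
      using y\<gamma>[OF that(1,2), of "{a}"] u(2)[OF that(2,3)] by (intro double_point_ideal_mult) auto
    then show ?thesis using that(3) by (simp add: \<phi>_def algebra_simps)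
  qed
  define g where "g x a b = (if a \<in> charts ?ns \<and> b \<in> charts ?ns then \<phi> x b - \<phi> x a else 0)" for x a b
  have gF: "\<phi> x b - \<phi> x a \<in> ?F {a, b}" if x: "x \<in> X" and ab: "a \<in> charts ?ns" "b \<in> charts ?ns" for x a b
  proof -
    have incl: "?L {a} \<subseteq> ?L {a, b}" "?L {b} \<subseteq> ?L {a, b}"
      "?J q {a} \<subseteq> ?J q {a, b}" "?J q {b} \<subseteq> ?J q {a, b}" for q
      by (simp_all add: line_bundle_mono double_point_ideal_mono)
    have L: "\<phi> x b - \<phi> x a \<in> ?L {a, b}"
      using \<phi>L[OF x ab(1)] \<phi>L[OF x ab(2)] incl(1,2) by (intro line_bundle_diff) auto
    have "?y a * (\<phi> x b - \<phi> x a) \<in> ?J q {a, b}" if q: "q \<in> S" for q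
    proof (cases "q \<in> chart_points ?ns {a, b}")
      case False
      then show ?thesis
        using chart_section_inv_mult[OF ab(1) _ L] by (simp add: double_point_ideal_outside)
    next
      case True
      \<comment> \<open>The section whose jet at \<open>q\<close> is prescribed does not depend on
        the chart, so both local sections agree with it to first order and their difference lies in
        the ideal.\<close>
      define \<delta> where "\<delta> = (if q = fst x then \<gamma> x else 0)"
      have loc: "?y c * (\<phi> x c - \<delta>) \<in> ?J q {a, b}" if c: "c \<in> {a, b}" for c
      proof -
        have cc: "c \<in> charts ?ns" "q \<in> chart_points ?ns {c}"
          using c ab True unfolding chart_points_def by auto
        have "?y c * (\<phi> x c - \<delta>) \<in> ?J q {c}"
          using \<phi>_other[OF x cc(1) q] \<phi>_same[OF x cc(1)] cc(2) by (cases "q = fst x") (auto simp: \<delta>_def)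
        then show ?thesis using incl(3,4)[of q] c by auto
      qed
      have "?y a * (\<phi> x b - \<delta>) \<in> ?J q {a, b}"
        by (rule double_point_ideal_change_chart[OF ab(2,1) _ loc]) auto
      then have "?y a * (\<phi> x b - \<delta>) - ?y a * (\<phi> x a - \<delta>) \<in> ?J q {a, b}"
        using loc[of a] by (intro double_point_ideal_diff) auto
      then show ?thesis by (simp add: algebra_simps)
    qed
    then show ?thesis
      using L twist_iff[OF ab(1), of "{a, b}"] by blast
  qed
  have "enat (card X) \<le> h1 ?ns ?F"
    unfolding h1_def
  proof (rule quotient_dim_ge[OF finX, where g = g])
    show "g x \<in> cech_cocycles1 (charts ?ns) ?F" if "x \<in> X" for x
      using gF[OF that] by (auto simp: cech_cocycles1_def g_def)
    have "0 \<in> ?F {a}" for a unfolding twist_def by (rule module_product_zero)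
    then show "0 \<in> cech_coboundaries1 (charts ?ns) ?F"
      unfolding cech_coboundaries1_def by (intro CollectI exI[of _ "\<lambda>_. 0"]) (auto simp: fun_eq_iff)
    show "(\<lambda>a b. const_laurent 0 * v a b) = 0" for v :: "(nat \<Rightarrow> nat) \<Rightarrow> (nat \<Rightarrow> nat) \<Rightarrow> 'k laurent"
      by (simp add: const_laurent_hom fun_eq_iff)
    show "(\<lambda>a b. const_laurent 1 * v a b) + (\<lambda>a b. const_laurent (- 1) * v a b) = 0"
      for v :: "(nat \<Rightarrow> nat) \<Rightarrow> (nat \<Rightarrow> nat) \<Rightarrow> 'k laurent"
      by (simp add: fun_eq_iff flip: distrib_right const_laurent_hom(1)) (simp add: const_laurent_hom)
    fix c assume "(\<Sum>x\<in>X. (\<lambda>a b. const_laurent (c x) * g x a b)) \<in> cech_coboundaries1 (charts ?ns) ?F"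
    then obtain K where K: "\<And>a. a \<in> charts ?ns \<Longrightarrow> K a \<in> ?F {a}"
      "(\<Sum>x\<in>X. (\<lambda>a b. const_laurent (c x) * g x a b)) =
        (\<lambda>a b. if a \<in> charts ?ns \<and> b \<in> charts ?ns then K b - K a else 0)"
      unfolding cech_coboundaries1_def by blast
    define H where "H a = (\<Sum>x\<in>X. const_laurent (c x) * \<phi> x a)" for a
    have HK: "H b - H a = K b - K a" if "a \<in> charts ?ns" "b \<in> charts ?ns" for a b
    proof -
      have "K b - K a = (\<Sum>x\<in>X. const_laurent (c x) * g x a b)"
        using that fun_cong[OF fun_cong[OF K(2), of a], of b] by (simp add: sum_fun2_apply)
      also have "\<dots> = H b - H a"
        using that by (simp add: H_def g_def right_diff_distrib sum_subtractf)
      finally show ?thesis by simp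
    qed
    have HL: "H a \<in> ?L {a}" if "a \<in> charts ?ns" for a
      unfolding H_def using \<phi>L that by (intro line_bundle_sum const_laurent_line_bundle) auto
    have KJ: "?y a * K a \<in> ?J q {a}" "K a \<in> ?L {a}" if "a \<in> charts ?ns" "q \<in> S" for a q
      using K(1)[OF that(1)] that twist_iff[OF that(1), of "{a}"] by blast+
    define a0 where "a0 = \<alpha> p0"
    have a0: "a0 \<in> charts ?ns" "p0 \<in> chart_points ?ns {a0}"
      unfolding a0_def using \<alpha> p0 by auto
    have const: "H a - K a = H a0 - K a0" if "a \<in> charts ?ns" for a
      using HK[OF a0(1) that] by (simp add: algebra_simps)
    \<comment> \<open>Two cochains with the same coboundary differ by a global section. Its jet at
      \<open>p0\<close> is zero, because no class prescribes a jet there, and a linear form with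
      zero jet at one point is zero.\<close>
    have "H a0 - K a0 \<in> ?L {a}" if "a \<in> charts ?ns" for a
      using line_bundle_diff[OF HL[OF that] KJ(2)[OF that p0]] const[OF that] by simp
    then obtain d where d: "H a0 - K a0 = chart_section ?ns a0 * jet ?ns a0 d"
      using global_section_eq_jet[OF n a0(1)] by blast
    have "(\<Sum>x\<in>X. const_laurent (c x) * (?y a0 * \<phi> x a0)) - ?y a0 * K a0 \<in> ?J p0 {a0}"
      using \<phi>_other[OF _ a0(1) p0] X(2) KJ(1)[OF a0(1) p0]
      by (intro double_point_ideal_diff double_point_ideal_sum double_point_ideal_const) auto
    then have "?y a0 * (H a0 - K a0) \<in> ?J p0 {a0}"
      by (simp add: H_def right_diff_distrib sum_distrib_left mult.left_commute)
    then have "jet ?ns a0 d \<in> ?J p0 {a0}" unfolding d by simp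
    then have "d t = 0" if "t \<in> jet_index ?ns a0" for t
      using jet_eq_zero[OF _ a0(2) _ that] by blast
    then have "jet ?ns a0 d = 0" unfolding jet_def by (simp add: const_laurent_hom)
    then have H_eq: "H a = K a" if "a \<in> charts ?ns" for a
      using const[OF that] d by simp
    show "\<forall>x\<in>X. c x = 0"
    proof
      fix x assume x: "x \<in> X"
      define p where "p = fst x"
      define t where "t = snd x"
      define a where "a = \<alpha> p"
      have p: "p \<in> S" "p \<noteq> p0" and t: "t \<in> jet_index ?ns a" using X[OF x] by (auto simp: p_def t_def a_def)
      have a: "a \<in> charts ?ns" "p \<in> chart_points ?ns {a}" using \<alpha> p by (auto simp: a_def)
      \<comment> \<open>To first order at \<open>p\<close> only the classes attached to
        \<open>p\<close> contribute. Since \<open>H\<close> equals \<open>K\<close>, whose jets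
        vanish, their prescribed jets combine to zero.\<close>
      define \<delta> where "\<delta> z = (if fst z = p then \<gamma> z else 0)" for z
      have "?y a * (\<phi> z a - \<delta> z) \<in> ?J p {a}" if "z \<in> X" for z
        using \<phi>_other[OF that a(1) p(1)] \<phi>_same[OF that a(1)] a(2)
        by (cases "fst z = p") (auto simp: \<delta>_def)
      then have "?y a * K a - (\<Sum>z\<in>X. const_laurent (c z) * (?y a * (\<phi> z a - \<delta> z))) \<in> ?J p {a}"
        using KJ(1)[OF a(1) p(1)]
        by (intro double_point_ideal_diff double_point_ideal_sum double_point_ideal_const) auto
      moreover have "?y a * K a - (\<Sum>z\<in>X. const_laurent (c z) * (?y a * (\<phi> z a - \<delta> z))) =
          ?y a * (\<Sum>z\<in>X. const_laurent (c z) * \<delta> z)"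
        unfolding H_eq[OF a(1), symmetric] H_def
        by (simp add: right_diff_distrib sum_subtractf sum_distrib_left mult.left_commute)
      moreover have "(\<Sum>z\<in>X. const_laurent (c z) * \<delta> z) = chart_section ?ns a * jet ?ns a (\<lambda>t. c (p, t))"
      proof -
        have "(\<Sum>z\<in>X. const_laurent (c z) * \<delta> z) =
            (\<Sum>z\<in>Pair p ` jet_index ?ns a. const_laurent (c z) * \<delta> z)"
          by (rule sum.mono_neutral_right[OF finX]) (auto simp: X_def \<delta>_def a_def p)
        also have "\<dots> = (\<Sum>t\<in>jet_index ?ns a. const_laurent (c (p, t)) * first_jet_section ?ns a t)"
          by (subst sum.reindex) (auto simp: inj_on_def \<delta>_def \<gamma>_def a_def)
        finally show ?thesis by (simp add: sum_first_jet_section)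
      qed
      ultimately have "jet ?ns a (\<lambda>t. c (p, t)) \<in> ?J p {a}" by simp
      then have "c (p, t) = 0"
        using jet_eq_zero[OF _ a(2) _ t] by blast
      then show "c x = 0" by (simp add: p_def t_def)
    qed
  qed
  then show ?thesis unfolding cardX .
qed

theorem proposition5p3:
  fixes n r :: nat
    and ns :: "nat list"
    and S :: "(nat \<Rightarrow> (nat \<Rightarrow> 'k :: {alg_closed_field, field_char_0}) set) set"
  assumes "n > 0" and "r \<ge> 2"
    and "\<forall>m\<in>set ns. m > 0" and "sum_list ns = n"
    and "S \<subseteq> multiproj_space ns" and "finite S" and "card S = r"
  shows "h1 ns (twist ns (\<lambda>_. 1) (double_points_ideal_sheaf ns S)) \<le> enat ((r - 1) * (n + 1)) \<and>
    (h1 ns (twist ns (\<lambda>_. 1) (double_points_ideal_sheaf ns S)) = enat ((r - 1) * (n + 1))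
       \<longleftrightarrow> length ns = 1)"
proof -
  let ?h = "h1 ns (twist ns (\<lambda>_. 1) (double_points_ideal_sheaf ns S))"
  obtain p where p: "p \<in> S" using assms by fastforce
  have "S \<noteq> {p}" using assms by auto
  then obtain q where q: "q \<in> S" "p \<noteq> q" using p by blast
  have le: "?h \<le> enat ((r - 1) * (n + 1))"
    using h1_double_points_le_one_point[OF assms(5,6) p] assms by simp
  moreover have "?h = enat ((r - 1) * (n + 1))" if "length ns = 1"
  proof -
    have "ns = [n]"
      using that assms(4) by (cases ns) auto
    then show ?thesis
      using le h1_double_points_ge[OF assms(1) _ assms(6) p] assms by (intro antisym) auto
  qed
  moreover have "?h \<noteq> enat ((r - 1) * (n + 1))" if "length ns \<noteq> 1"
  proof -
    have "length ns \<noteq> 0" using assms by auto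
    then have "length ns \<ge> 2" using that by linarith
    then show ?thesis
      using h1_double_points_less[OF assms(5,6) p q _ assms(3)] assms by simp
  qed
  ultimately show ?thesis by blast
qed

end
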